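(* There exist constants $C,c_4,c_5>0$ and a family of DAGs $\{G_n\}_{n\ge 2}$ such that each $G_n$ has at most $Cn$ nodes, maximum indegree at most $2$, and $\Pi^{\parallel}_{ss}\left(G_n,\,c_4 n/\log n\right)\ge c_5 n$.
   Context: For a DAG $G=(V,E)$, a parallel pebbling of $G$ is a sequence $P=(P_0,P_1,\ldots,P_t)$ of subsets of $V$ with $P_0=\emptyset$; it is legal if for every $i\in[t]$ and every $x\in P_i\setminus P_{i-1}$ we have $\mathsf{parents}(x)\subseteq P_{i-1}$. It is complete if every sink of $G$ belongs to some $P_z$. $\mathcal{P}^{\parallel}_G$ denotes the set of complete legal parallel pebblings of $G$. For $s\ge0$ the $s$-sustained space complexity of $P$ is $\Pi_{ss}(P,s)=|\{i\in[t]:|P_i|\ge s\}|$, and $\Pi^{\parallel}_{ss}(G,s)=\min_{P\in\mathcal{P}^{\parallel}_G}\Pi_{ss}(P,s)$. Logarithms are base 2. *)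

theory Defs
  imports Complex_Main
begin

type_synonym dag = "nat set \<times> (nat \<times> nat) set"

definition is_dag :: "dag \<Rightarrow> bool" where
  "is_dag G \<longleftrightarrow> finite (fst G) \<and> snd G \<subseteq> fst G \<times> fst G \<and> acyclic (snd G)"

definition parents :: "dag \<Rightarrow> nat \<Rightarrow> nat set" where
  "parents G x = {u. (u, x) \<in> snd G}"

definition indeg_le :: "dag \<Rightarrow> nat \<Rightarrow> bool" where
  "indeg_le G d \<longleftrightarrow> (\<forall>x \<in> fst G. card (parents G x) \<le> d)"

definition sinks :: "dag \<Rightarrow> nat set" where
  "sinks G = {x \<in> fst G. \<forall>y. (x, y) \<notin> snd G}"

definition legal_pebbling :: "dag \<Rightarrow> nat set list \<Rightarrow> bool" where
  "legal_pebbling G P \<longleftrightarrow> P \<noteq> [] \<and> P ! 0 = {} \<and> (\<forall>i < length P. P ! i \<subseteq> fst G) \<and>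
     (\<forall>i. 1 \<le> i \<and> i < length P \<longrightarrow>
        (\<forall>x \<in> P ! i - P ! (i - 1). parents G x \<subseteq> P ! (i - 1)))"

definition complete_pebbling :: "dag \<Rightarrow> nat set list \<Rightarrow> bool" where
  "complete_pebbling G P \<longleftrightarrow> (\<forall>x \<in> sinks G. \<exists>z < length P. x \<in> P ! z)"

definition par_pebblings :: "dag \<Rightarrow> nat set list set" where
  "par_pebblings G = {P. legal_pebbling G P \<and> complete_pebbling G P}"

definition ss_cost :: "nat set list \<Rightarrow> real \<Rightarrow> nat" where
  "ss_cost P s = card {i \<in> {1..<length P}. real (card (P ! i)) \<ge> s}"

definition ss_par :: "dag \<Rightarrow> real \<Rightarrow> nat" where
  "ss_par G s = (INF P \<in> par_pebblings G. ss_cost P s)"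

end

theory Submission
  imports Defs "HOL-Library.FuncSet" "HOL-Library.Countable"
begin

text \<open>
  Let N be a power of two. A recursive graph in the style of Paul, Tarjan and Celoni, with N log N nodes
  and expanders in place of superconcentrators, has the following property: if a pebbling starts with
  few pebbles and then reaches half of the sinks, there is a time interval throughout which at least
  N/256 pebbles lie on the graph and during which 63/64 of the sources get newly pebbled. Indeed, by
  induction the second half graph enforces such an interval, during which the sinks of the first half
  graph have to be pebbled as well, and the two halves then add up their pebbles.

  The sources themselves carry a depth-robust graph of indegree O(log N), in the style of Erdos, Graham
  and Szemeredi, made of expanders between adjacent dyadic blocks of every scale: any 63/64 of its
  nodes induce a path of linear length. Every node is replaced by a chain that reads its parents one by
  one, with an additional delay of log N for sources. Indegrees drop to two, and the interval
  above lasts for a number of steps of order N log N.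
\<close>

section \<open>Bipartite expanders\<close>

text \<open>In a parallel pebbling, sources without edges among them could all be pebbled in one
  step, so the number of newly pebbled sources alone says nothing about the duration of the
  interval; the path among the sources turns this count into time. Only the \<open>2^k\<close>
  sources of the outermost copy get indegree and delay of order \<open>k\<close>. They cost about as
  many vertices as all the other nodes together, so up to a constant the interval is as long as the
  graph is large. The argument never needs disjoint paths. It compares large fractions of two sides,
  and for this it suffices that any two sets making up 1/128 of either side are joined by an edge,
  which a random bipartite graph of constant degree achieves. Losses of a few 128ths do not
  accumulate over the levels: every level obtains its 63/64 of the sources afresh from its own
  expanders, and only the pebble counts are added.\<close>

lemma card_avoiding_functions:
  assumes "A \<subseteq> {..<p}" "B \<subseteq> {..<q}" "p \<le> 128 * card A"
  shows "real (card {f \<in> ({..<q} \<times> {..<D}) \<rightarrow>\<^sub>E {..<p}. \<forall>b\<in>B. \<forall>d<D. f (b, d) \<notin> A})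
         \<le> real p ^ (q * D) * (127 / 128) ^ (card B * D)"
proof -
  define X where "X = (\<lambda>bd :: nat \<times> nat. if fst bd \<in> B then {..<p} - A else {..<p})"
  have finA: "finite A" and finB: "finite B"
    using assms finite_subset by blast+
  have "{f \<in> ({..<q} \<times> {..<D}) \<rightarrow>\<^sub>E {..<p}. \<forall>b\<in>B. \<forall>d<D. f (b, d) \<notin> A}
        \<subseteq> PiE ({..<q} \<times> {..<D}) X"
    by (auto simp: PiE_def Pi_def X_def)
  moreover have "finite (PiE ({..<q} \<times> {..<D}) X)"
    by (intro finite_PiE) (auto simp: X_def)
  ultimately have "card {f \<in> ({..<q} \<times> {..<D}) \<rightarrow>\<^sub>E {..<p}. \<forall>b\<in>B. \<forall>d<D. f (b, d) \<notin> A}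
        \<le> card (PiE ({..<q} \<times> {..<D}) X)"
    by (intro card_mono)
  also have "\<dots> = (\<Prod>bd\<in>{..<q} \<times> {..<D}. card (X bd))"
    by (simp add: card_PiE)
  finally have "real (card {f \<in> ({..<q} \<times> {..<D}) \<rightarrow>\<^sub>E {..<p}. \<forall>b\<in>B. \<forall>d<D. f (b, d) \<notin> A})
      \<le> (\<Prod>bd\<in>{..<q} \<times> {..<D}. real (card (X bd)))"
    unfolding of_nat_prod[symmetric] of_nat_le_iff .
  also have "\<dots> \<le> (\<Prod>bd\<in>{..<q} \<times> {..<D}. real p * (if fst bd \<in> B then 127 / 128 else 1))"
  proof (intro prod_mono conjI)
    fix bd :: "nat \<times> nat"
    have "card ({..<p} - A) = p - card A"
      using assms(1) finA by (simp add: card_Diff_subset)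
    then show "real (card (X bd)) \<le> real p * (if fst bd \<in> B then 127 / 128 else 1)"
      using assms(3) by (auto simp: X_def)
  qed simp
  also have "\<dots> = real p ^ (q * D) *
      (\<Prod>bd\<in>{..<q} \<times> {..<D}. if fst bd \<in> B then 127 / 128 else 1)"
    by (simp add: prod.distrib)
  also have "(\<Prod>bd\<in>{..<q} \<times> {..<D}. if fst bd \<in> B then 127 / 128 else (1::real))
      = (\<Prod>bd\<in>B \<times> {..<D}. 127 / 128)"
    using assms(2) by (intro prod.mono_neutral_cong_right) auto
  also have "\<dots> = (127 / 128) ^ (card B * D)"
    by (simp add: card_cartesian_product)
  finally show ?thesis .
qed

definition is_expander :: "nat \<Rightarrow> nat \<Rightarrow> nat \<Rightarrow> (nat \<Rightarrow> nat \<Rightarrow> nat) \<Rightarrow> bool" where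
  "is_expander D p q E \<longleftrightarrow> (\<forall>b<q. \<forall>d<D. E b d < p) \<and>
     (\<forall>A \<subseteq> {..<p}. \<forall>B \<subseteq> {..<q}. p \<le> 128 * card A \<longrightarrow> q \<le> 128 * card B \<longrightarrow>
        (\<exists>b\<in>B. \<exists>d<D. E b d \<in> A))"

text \<open>Union bound: there are at most \<open>8 ^ q\<close> pairs of sets, and a random
  \<open>f\<close> leaves a given large pair unjoined with probability at most
  \<open>(127/128) ^ (w * q)\<close>. The left side may be twice as large as the right one because a
  block will be joined to its halves.\<close>

lemma expanders_exist:
  "\<exists>D. \<forall>p q. 0 < p \<longrightarrow> 0 < q \<longrightarrow> p \<le> 2 * q \<longrightarrow> (\<exists>E. is_expander D p q E)"
proof -
  obtain w where w: "(127 / 128 :: real) ^ w < 1 / 8"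
    using real_arch_pow_inv[of "1/8" "127/128 :: real"] by auto
  \<comment> \<open>A set \<open>B\<close> with at least \<open>q / 128\<close> elements then
    involves \<open>card B * D\<close>, hence at least \<open>w * q\<close>, independent
    choices.\<close>
  define D where "D = 128 * w"
  have "\<exists>E. is_expander D p q E" if p: "0 < p" and q: "0 < q" and pq: "p \<le> 2 * q" for p q
  proof (rule ccontr)
    assume none: "\<nexists>E. is_expander D p q E"
    define \<Omega> where "\<Omega> = ({..<q} \<times> {..<D}) \<rightarrow>\<^sub>E {..<p}"
    define I where "I = {A. A \<subseteq> {..<p} \<and> p \<le> 128 * card A} \<times> {B. B \<subseteq> {..<q} \<and> q \<le> 128 * card B}"
    define bad where "bad = (\<lambda>(A, B). {f \<in> \<Omega>. \<forall>b\<in>B. \<forall>d<D. f (b, d) \<notin> A})"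
    have I_sub: "I \<subseteq> Pow {..<p} \<times> Pow {..<q}"
      by (auto simp: I_def)
    then have finI: "finite I"
      by (rule finite_subset) simp
    have "card I \<le> card (Pow {..<p} \<times> Pow {..<q})"
      using I_sub by (intro card_mono) auto
    also have "\<dots> = 2 ^ (p + q)"
      by (simp add: card_cartesian_product card_Pow power_add)
    also have "\<dots> \<le> 2 ^ (3 * q)"
      using pq by (intro power_increasing) auto
    also have "\<dots> = 8 ^ q"
      by (simp add: power_mult)
    finally have "real (card I) \<le> real (8 ^ q)"
      by (rule of_nat_mono)
    then have cardI: "real (card I) \<le> 8 ^ q"
      by simp
    have fin\<Omega>: "finite \<Omega>"
      unfolding \<Omega>_def by (intro finite_PiE) auto
    have "\<Omega> \<subseteq> (\<Union>i\<in>I. bad i)"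
    proof
      fix f assume f: "f \<in> \<Omega>"
      then have "\<forall>b<q. \<forall>d<D. f (b, d) < p"
        by (auto simp: \<Omega>_def PiE_def Pi_def)
      moreover have "\<not> is_expander D p q (\<lambda>b d. f (b, d))"
        using none by blast
      ultimately obtain A B where "A \<subseteq> {..<p}" "B \<subseteq> {..<q}" "p \<le> 128 * card A"
          "q \<le> 128 * card B" "\<forall>b\<in>B. \<forall>d<D. f (b, d) \<notin> A"
        unfolding is_expander_def by blast
      then show "f \<in> (\<Union>i\<in>I. bad i)"
        using f by (auto simp: I_def bad_def)
    qed
    then have "card \<Omega> \<le> card (\<Union>i\<in>I. bad i)"
      using finI fin\<Omega> by (intro card_mono) (auto simp: bad_def)
    also have "\<dots> \<le> (\<Sum>i\<in>I. card (bad i))"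
      by (rule card_UN_le[OF finI])
    finally have "real (card \<Omega>) \<le> (\<Sum>i\<in>I. real (card (bad i)))"
      by (metis of_nat_le_iff of_nat_sum)
    also have "\<dots> \<le> (\<Sum>i\<in>I. real p ^ (q * D) * ((127 / 128) ^ w) ^ q)"
    proof (intro sum_mono)
      fix i assume "i \<in> I"
      then obtain A B where i: "i = (A, B)" and AB: "A \<subseteq> {..<p}" "p \<le> 128 * card A"
          "B \<subseteq> {..<q}" "q \<le> 128 * card B"
        by (auto simp: I_def)
      have "real (card (bad i)) \<le> real p ^ (q * D) * (127 / 128) ^ (card B * D)"
        using card_avoiding_functions[OF AB(1,3,2)] by (simp add: i bad_def \<Omega>_def)
      also have "\<dots> \<le> real p ^ (q * D) * (127 / 128) ^ (w * q)"
      proof -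
        have "w * q \<le> w * (128 * card B)"
          using AB(4) by (intro mult_le_mono2)
        then have "w * q \<le> card B * D"
          by (simp add: D_def mult_ac)
        then show ?thesis
          by (intro mult_left_mono power_decreasing) auto
      qed
      finally show "real (card (bad i)) \<le> real p ^ (q * D) * ((127 / 128) ^ w) ^ q"
        by (simp add: power_mult)
    qed
    also have "\<dots> = real (card I) * (real p ^ (q * D) * ((127 / 128) ^ w) ^ q)"
      by simp
    also have "\<dots> \<le> 8 ^ q * (real p ^ (q * D) * ((127 / 128) ^ w) ^ q)"
      using cardI by (intro mult_right_mono) auto
    also have "\<dots> = (8 * (127 / 128) ^ w) ^ q * real p ^ (q * D)"
      by (simp add: power_mult_distrib)
    also have "\<dots> < 1 * real p ^ (q * D)"
    proof (rule mult_strict_right_mono)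
      show "(8 * (127 / 128 :: real) ^ w) ^ q < 1"
        using w q by (intro power_less_one_iff[THEN iffD2]) auto
    qed (use p in auto)
    also have "\<dots> = real (card \<Omega>)"
      by (simp add: \<Omega>_def card_PiE card_cartesian_product)
    finally show False
      by simp
  qed
  then show ?thesis
    by blast
qed

section \<open>Recursive doubling of sustained space\<close>

definition expands :: "('v \<Rightarrow> 'v set) \<Rightarrow> 'v set \<Rightarrow> 'v set \<Rightarrow> bool" where
  "expands par A B \<longleftrightarrow> (\<forall>Y \<subseteq> B. card B \<le> 128 * card Y \<longrightarrow>
      128 * card (A - (\<Union>y\<in>Y. par y)) < card A)"

text \<open>Serves to move the start of an interval back to the last time with few pebbles: only
  those few can spoil a count of new nodes, and all times in between have many pebbles.\<close>

lemma last_low_time: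
  assumes "P (s::nat)" "s \<le> z"
  shows "\<exists>z0. s \<le> z0 \<and> z0 \<le> z \<and> P z0 \<and> (\<forall>y. z0 < y \<and> y \<le> z \<longrightarrow> \<not> P y)"
proof -
  let ?A = "{y. y \<le> z \<and> P y}"
  have A: "finite ?A" "s \<in> ?A"
    using assms by auto
  then obtain M where M: "M \<in> ?A" "\<forall>y\<in>?A. y \<le> M"
    using Max_in[of ?A] Max_ge[of ?A] by blast
  then show ?thesis
    using A(2) by (intro exI[of _ M]) (auto simp flip: not_le)
qed

text \<open>
  For a graph whose nodes are expanded into chains, Q y is the set of nodes whose chain carries a pebble
  at time y, and R y the set of those whose chain is pebbled at its end.
\<close>

locale coarse_pebbling =
  fixes par :: "'v \<Rightarrow> 'v set" and Q R :: "nat \<Rightarrow> 'v set"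
  assumes finite_Q: "finite (Q y)"
    and R_subset_Q: "R y \<subseteq> Q y"
    and legal: "\<lbrakk>v \<notin> Q z; v \<in> R t; z < t; u \<in> par v\<rbrakk> \<Longrightarrow> \<exists>y. z \<le> y \<and> y < t \<and> u \<in> R y"
begin

text \<open>Absence is measured by \<open>Q\<close> and completion by \<open>R\<close>, so the whole
  chain of a new node has to be traversed inside the interval.\<close>

definition new :: "nat \<Rightarrow> nat \<Rightarrow> 'v set" where
  "new z t = {v. v \<notin> Q z \<and> (\<exists>y. z < y \<and> y \<le> t \<and> v \<in> R y)}"

lemma new_split: "new z t \<subseteq> new z (s - 1) \<union> Q s \<union> new s t"
proof
  fix v assume "v \<in> new z t"
  then obtain y where y: "v \<notin> Q z" "z < y" "y \<le> t" "v \<in> R y"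
    by (auto simp: new_def)
  consider "y < s" | "y = s" | "s < y"
    by linarith
  then show "v \<in> new z (s - 1) \<union> Q s \<union> new s t"
  proof cases
    case 1
    then have "y \<le> s - 1"
      by simp
    then show ?thesis
      using y by (auto simp: new_def)
  next
    case 2
    then show ?thesis
      using y R_subset_Q by auto
  next
    case 3
    then show ?thesis
      using y by (auto simp: new_def)
  qed
qed

lemma new_extend_left: "z0 \<le> z \<Longrightarrow> new z t \<subseteq> new z0 t \<union> Q z0"
  by (auto simp: new_def intro: le_less_trans)

text \<open>A new node of \<open>B\<close> needs each parent completed at some time from
  \<open>z\<close> on, and a parent outside \<open>Q z\<close> is then new as well. Fewer than 1/128
  of \<open>A\<close> have no child among the new nodes of \<open>B\<close>.\<close>

lemma new_expand:
  assumes "expands par A B" "finite A" "card B \<le> 128 * card (B \<inter> new z t)"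
  shows "127 * card A < 128 * card (A \<inter> new z t) + 128 * card (A \<inter> Q z)"
proof -
  define X where "X = A - (\<Union>y\<in>B \<inter> new z t. par y)"
  have X: "128 * card X < card A"
    using assms(1,3) unfolding expands_def X_def by blast
  have "A \<subseteq> X \<union> (A \<inter> new z t) \<union> (A \<inter> Q z)"
  proof
    fix u assume u: "u \<in> A"
    show "u \<in> X \<union> (A \<inter> new z t) \<union> (A \<inter> Q z)"
    proof (cases "u \<in> X \<or> u \<in> Q z")
      case False
      then obtain v where v: "v \<in> new z t" "u \<in> par v"
        using u by (auto simp: X_def)
      then obtain t' where t': "v \<notin> Q z" "v \<in> R t'" "z < t'" "t' \<le> t"
        by (auto simp: new_def)
      then obtain y where y: "z \<le> y" "y < t'" "u \<in> R y"
        using legal v(2) by blast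
      moreover have "y \<noteq> z"
        using y False R_subset_Q by auto
      ultimately show ?thesis
        using False u t'(4) by (auto simp: new_def intro!: exI[of _ y])
    qed (use u in auto)
  qed
  then have "card A \<le> card (X \<union> (A \<inter> new z t) \<union> (A \<inter> Q z))"
    using assms(2) by (intro card_mono) (auto simp: X_def)
  also have "\<dots> \<le> card X + card (A \<inter> new z t) + card (A \<inter> Q z)"
    using card_Un_le[of "X \<union> (A \<inter> new z t)" "A \<inter> Q z"] card_Un_le[of X "A \<inter> new z t"]
    by linarith
  finally show ?thesis
    using X by linarith
qed

text \<open>The fraction 63/64 is \<open>1 - 2/128\<close>: one 128th of the sources is missed by
  the expander and one may be pebbled already at \<open>z\<close>. The bound 1/256 arises from the
  threshold 1/128 of a half: more than \<open>m / 128\<close> pebbles are \<open>2 * m / 256\<close>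
  for the doubled size \<open>2 * m\<close>.\<close>

definition sustained :: "nat \<Rightarrow> 'v set \<Rightarrow> 'v set \<Rightarrow> nat \<Rightarrow> nat \<Rightarrow> bool" where
  "sustained m V S z t \<longleftrightarrow> z \<le> t \<and> (\<forall>y. z < y \<and> y \<le> t \<longrightarrow> m \<le> 256 * card (Q y \<inter> V)) \<and>
     63 * m \<le> 64 * card (S \<inter> new z t)"

definition robust :: "nat \<Rightarrow> 'v set \<Rightarrow> 'v set \<Rightarrow> 'v set \<Rightarrow> bool" where
  "robust m V S T \<longleftrightarrow> (\<forall>z t. 128 * card (Q z \<inter> V) \<le> m \<longrightarrow> m \<le> 2 * card (T \<inter> new z t) \<longrightarrow>
     (\<exists>z' t'. z \<le> z' \<and> t' \<le> t \<and> sustained m V S z' t'))"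

context
  fixes m :: nat and V S :: "'v set"
  assumes fin: "finite V" and S: "S \<subseteq> V" "card S = 2 * m" and m: "0 < m"
begin

lemma sustained_if_high:
  assumes "z \<le> t" "\<And>y. z < y \<Longrightarrow> y \<le> t \<Longrightarrow> 2 * m \<le> 256 * card (Q y \<inter> V)"
    and "128 * card (Q z \<inter> V) \<le> 2 * m" "expands par S B" "card B \<le> 128 * card (B \<inter> new z t)"
  shows "sustained (2 * m) V S z t"
proof -
  have "127 * card S < 128 * card (S \<inter> new z t) + 128 * card (S \<inter> Q z)"
    using new_expand[OF assms(4) _ assms(5)] fin S(1) finite_subset by blast
  moreover have "card (S \<inter> Q z) \<le> card (Q z \<inter> V)"
    using fin S by (intro card_mono) auto
  ultimately show ?thesis
    using assms(1,2,3) S(2) by (auto simp: sustained_def)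
qed

text \<open>
  Either the graph stays heavily pebbled from z0 until many nodes of B have been completed, and then the
  expander from S to B forces almost all of S into that interval; or there is an early time s with few
  pebbles after which most of the work on B remains to be done.
\<close>

lemma sustained_or_low:
  assumes z: "z0 \<le> z" "z \<le> t" "128 * card (Q z0 \<inter> V) \<le> 2 * m"
    and high: "\<And>y. z0 < y \<Longrightarrow> y \<le> z \<Longrightarrow> m < 128 * card (Q y \<inter> V)"
    and B: "B \<subseteq> V" "expands par S B" "card B \<le> 2 * m" "6 * m \<le> 128 * card (B \<inter> new z t)"
  shows "(\<exists>t'\<le>t. sustained (2 * m) V S z0 t') \<or>
     (\<exists>s. z \<le> s \<and> s \<le> t \<and> 128 * card (Q s \<inter> V) \<le> m \<and>
          128 * card (B \<inter> new z t) \<le> 128 * card (B \<inter> new s t) + 5 * m)"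
proof -
  have finB: "finite B"
    using B(1) fin finite_subset by blast
  have split0: "card (B \<inter> new z t') \<le> card (B \<inter> new z0 t') + card (Q z0 \<inter> V)" for t'
  proof -
    have "card (B \<inter> new z t') \<le> card ((B \<inter> new z0 t') \<union> (Q z0 \<inter> V))"
      using new_extend_left[OF z(1), of t'] B(1) finB fin by (intro card_mono) auto
    then show ?thesis
      using card_Un_le le_trans by blast
  qed
  show ?thesis
  proof (cases "\<exists>s\<ge>z. s \<le> t \<and> 128 * card (Q s \<inter> V) \<le> m")
    case False
    have "sustained (2 * m) V S z0 t"
    proof (rule sustained_if_high)
      show "2 * m \<le> 256 * card (Q y \<inter> V)" if "z0 < y" "y \<le> t" for y
        using False high[of y] that by (cases "y \<le> z") force+
      show "card B \<le> 128 * card (B \<inter> new z0 t)"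
        using split0[of t] z(3) B(3,4) by linarith
    qed (use z B in auto)
    then show ?thesis
      by blast
  next
    case True
    define s where "s = (LEAST s. z \<le> s \<and> s \<le> t \<and> 128 * card (Q s \<inter> V) \<le> m)"
    have s: "z \<le> s" "s \<le> t" "128 * card (Q s \<inter> V) \<le> m"
      using LeastI_ex[OF True[simplified]] unfolding s_def by auto
    have before_s: "m < 128 * card (Q y \<inter> V)" if "z \<le> y" "y < s" for y
      using not_less_Least[of y "\<lambda>s. z \<le> s \<and> s \<le> t \<and> 128 * card (Q s \<inter> V) \<le> m"] that s(2)
      unfolding s_def by force
    show ?thesis
    proof (cases "card B \<le> 128 * card (B \<inter> new z0 (s - 1)) \<and> z0 \<le> s - 1")
      case True
      have "sustained (2 * m) V S z0 (s - 1)"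
      proof (rule sustained_if_high)
        show "2 * m \<le> 256 * card (Q y \<inter> V)" if "z0 < y" "y \<le> s - 1" for y
          using before_s[of y] high[of y] that by (cases "y \<le> z") force+
      qed (use z B True in auto)
      then show ?thesis
        using s by (intro disjI1 exI[of _ "s - 1"]) auto
    next
      case False
      have few: "128 * card (B \<inter> new z0 (s - 1)) \<le> 2 * m"
      proof (cases "z0 \<le> s - 1")
        case True
        then show ?thesis
          using False B(3) by linarith
      next
        case False
        then have "new z0 (s - 1) = {}"
          by (auto simp: new_def)
        then show ?thesis
          by simp
      qed
      \<comment> \<open>Multiplied by 128, the loss \<open>5 * m\<close> consists of
        \<open>2 * m\<close> for nodes completed between \<open>z0\<close> and \<open>s\<close>,
        \<open>2 * m\<close> for nodes pebbled at \<open>z0\<close>, and \<open>m\<close> for nodes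
        pebbled at \<open>s\<close>.\<close>
      have "card (B \<inter> new z t) \<le> card ((B \<inter> new z (s - 1)) \<union> (Q s \<inter> V) \<union> (B \<inter> new s t))"
        using new_split[of z t s] B(1) finB fin by (intro card_mono) auto
      also have "\<dots> \<le> card (B \<inter> new z (s - 1)) + card (Q s \<inter> V) + card (B \<inter> new s t)"
        using card_Un_le[of "(B \<inter> new z (s - 1)) \<union> (Q s \<inter> V)" "B \<inter> new s t"]
          card_Un_le[of "B \<inter> new z (s - 1)" "Q s \<inter> V"] by linarith
      finally have "128 * card (B \<inter> new z t) \<le> 128 * card (B \<inter> new s t) + 5 * m"
        using few split0[of "s - 1"] z(3) s(3) by linarith
      then show ?thesis
        using s by blast
    qed
  qed
qed

text \<open>Work on \<open>T\<close> forces work on \<open>T2\<close>, then on \<open>S2\<close>,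
  then on \<open>T1\<close>, then on \<open>S1\<close>, each half being entered at a time with few
  pebbles. Whenever space instead stays high long enough, a direct expander from \<open>S\<close> to
  \<open>T\<close>, \<open>S2\<close> or \<open>S1\<close> yields the new sources; this is the
  purpose of these three edge families.\<close>

lemma robust_double:
  assumes T: "T \<subseteq> V" "card T = 2 * m"
    and V1: "V1 \<subseteq> V" "S1 \<subseteq> V1" "T1 \<subseteq> V1" "card S1 = m" "card T1 = m"
    and V2: "V2 \<subseteq> V" "S2 \<subseteq> V2" "T2 \<subseteq> V2" "card S2 = m" "card T2 = m"
    and disj: "V1 \<inter> V2 = {}"
    and exps: "expands par S T" "expands par T2 T" "expands par S S2" "expands par T1 S2"
      "expands par S S1"
    and IH1: "robust m V1 S1 T1" and IH2: "robust m V2 S2 T2"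
  shows "robust (2 * m) V S T"
  unfolding robust_def
proof (intro allI impI)
  fix z t
  assume low: "128 * card (Q z \<inter> V) \<le> 2 * m" and many: "2 * m \<le> 2 * card (T \<inter> new z t)"
  let ?goal = "\<exists>z' t'. z \<le> z' \<and> t' \<le> t \<and> sustained (2 * m) V S z' t'"
  have le_V: "card (Q y \<inter> W) \<le> card (Q y \<inter> V)" "card (W \<inter> Q y) \<le> card (Q y \<inter> V)"
    if "W \<subseteq> V" for W y
    using that fin by (auto intro!: card_mono)
  have fins: "finite T1" "finite T2" "finite S1" "finite S2"
    using V1 V2 fin by (meson finite_subset)+
  have "new z t \<noteq> {}"
    using many m by auto
  then have "z \<le> t"
    by (auto simp: new_def)
  then have "(\<exists>t'\<le>t. sustained (2 * m) V S z t') \<or>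
     (\<exists>s. z \<le> s \<and> s \<le> t \<and> 128 * card (Q s \<inter> V) \<le> m \<and>
          128 * card (T \<inter> new z t) \<le> 128 * card (T \<inter> new s t) + 5 * m)"
    using sustained_or_low[of z z t T] low many T exps(1) by auto
  then show ?goal
  proof (elim disjE exE conjE)
    fix z1 assume z1: "z \<le> z1" "z1 \<le> t" "128 * card (Q z1 \<inter> V) \<le> m"
      and T_new: "128 * card (T \<inter> new z t) \<le> 128 * card (T \<inter> new z1 t) + 5 * m"
    have "127 * card T2 < 128 * card (T2 \<inter> new z1 t) + 128 * card (T2 \<inter> Q z1)"
      using new_expand[OF exps(2) fins(2)] T_new many T(2) by auto
    then have "m \<le> 2 * card (T2 \<inter> new z1 t)"
      using le_V(2)[OF order_trans[OF V2(3,1)], of z1] V2(5) z1(3) by linarith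
    moreover have "128 * card (Q z1 \<inter> V2) \<le> m"
      using le_V(1)[of V2 z1] V2 z1(3) by auto
    ultimately obtain z' t' where zt': "z1 \<le> z'" "t' \<le> t" and sus2: "sustained m V2 S2 z' t'"
      using IH2 unfolding robust_def by blast
    \<comment> \<open>Nothing is known about the pebbles on all of \<open>V\<close> at
      \<open>z'\<close>, so the start is moved back to a time when they are few.\<close>
    obtain z0 where z0: "z1 \<le> z0" "z0 \<le> z'" "128 * card (Q z0 \<inter> V) \<le> m"
        "\<forall>y. z0 < y \<and> y \<le> z' \<longrightarrow> \<not> 128 * card (Q y \<inter> V) \<le> m"
      using last_low_time[of "\<lambda>y. 128 * card (Q y \<inter> V) \<le> m" z1 z'] z1(3) zt'(1) by blast
    have S2_new: "63 * m \<le> 64 * card (S2 \<inter> new z' t')" and "z' \<le> t'"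
      using sus2 by (auto simp: sustained_def)
    then have "(\<exists>t''\<le>t'. sustained (2 * m) V S z0 t'') \<or>
       (\<exists>s. z' \<le> s \<and> s \<le> t' \<and> 128 * card (Q s \<inter> V) \<le> m \<and>
          128 * card (S2 \<inter> new z' t') \<le> 128 * card (S2 \<inter> new s t') + 5 * m)"
      using z0 V2 exps(3) by (intro sustained_or_low) auto
    then show ?goal
    proof (elim disjE exE conjE)
      fix z2 assume z2: "z' \<le> z2" "z2 \<le> t'" "128 * card (Q z2 \<inter> V) \<le> m"
        and S2_new': "128 * card (S2 \<inter> new z' t') \<le> 128 * card (S2 \<inter> new z2 t') + 5 * m"
      have "127 * card T1 < 128 * card (T1 \<inter> new z2 t') + 128 * card (T1 \<inter> Q z2)"
        using new_expand[OF exps(4) fins(1)] S2_new S2_new' V2(4) by auto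
      then have "m \<le> 2 * card (T1 \<inter> new z2 t')"
        using le_V(2)[OF order_trans[OF V1(3,1)], of z2] V1(5) z2(3) by linarith
      moreover have "128 * card (Q z2 \<inter> V1) \<le> m"
        using le_V(1)[of V1 z2] V1 z2(3) by auto
      ultimately obtain z3 t3 where zt3: "z2 \<le> z3" "t3 \<le> t'" and sus1: "sustained m V1 S1 z3 t3"
        using IH1 unfolding robust_def by blast
      obtain z4 where z4: "z2 \<le> z4" "z4 \<le> z3" "128 * card (Q z4 \<inter> V) \<le> m"
          "\<forall>y. z4 < y \<and> y \<le> z3 \<longrightarrow> \<not> 128 * card (Q y \<inter> V) \<le> m"
        using last_low_time[of "\<lambda>y. 128 * card (Q y \<inter> V) \<le> m" z2 z3] z2(3) zt3(1) by blast
      have "sustained (2 * m) V S z4 t3"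
      proof (rule sustained_if_high[OF _ _ _ exps(5)])
        show "z4 \<le> t3"
          using z4(2) sus1 by (auto simp: sustained_def)
        show "2 * m \<le> 256 * card (Q y \<inter> V)" if y: "z4 < y" "y \<le> t3" for y
        proof (cases "y \<le> z3")
          case True
          then show ?thesis
            using z4(4) y by auto
        next
          case False
          \<comment> \<open>The interval found for the first half is nested in that of the second,
            so both bounds hold at \<open>y\<close>, and the halves are disjoint.\<close>
          then have "m \<le> 256 * card (Q y \<inter> V1)" "m \<le> 256 * card (Q y \<inter> V2)"
            using sus1 sus2 y zt3 z2 by (auto simp: sustained_def)
          moreover have "card (Q y \<inter> V1) + card (Q y \<inter> V2) = card ((Q y \<inter> V1) \<union> (Q y \<inter> V2))"
            using disj finite_Q by (intro card_Un_disjoint[symmetric]) auto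
          moreover have "\<dots> \<le> card (Q y \<inter> V)"
            using V1 V2 finite_Q by (intro card_mono) auto
          ultimately show ?thesis
            by linarith
        qed
        show "128 * card (Q z4 \<inter> V) \<le> 2 * m"
          using z4(3) by linarith
        have "card (S1 \<inter> new z3 t3) \<le> card ((S1 \<inter> new z4 t3) \<union> (Q z4 \<inter> V))"
          using new_extend_left[OF z4(2), of t3] V1 fins(3) fin by (intro card_mono) auto
        also have "\<dots> \<le> card (S1 \<inter> new z4 t3) + card (Q z4 \<inter> V)"
          by (rule card_Un_le)
        finally show "card S1 \<le> 128 * card (S1 \<inter> new z4 t3)"
          using z4(3) sus1 V1(4) by (auto simp: sustained_def)
      qed
      then show ?goal
        using z1 zt' z2 zt3 z4 by (meson le_trans)
    qed (use z1 z0 zt' le_trans in blast)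
  qed blast
qed

end

text \<open>For size 1, few pebbles means none. The interval runs from the last time at which the
  chain of \<open>u\<close> is empty until \<open>u\<close> is completed, so \<open>u\<close> itself
  supplies the required pebble.\<close>

lemma robust_pair:
  assumes "par v = {u}" "u \<noteq> v"
  shows "robust 1 {u, v} {u} {v}"
  unfolding robust_def
proof (intro allI impI)
  fix z t
  assume low: "128 * card (Q z \<inter> {u, v}) \<le> 1" and new: "1 \<le> 2 * card ({v} \<inter> new z t)"
  have "card (Q z \<inter> {u, v}) = 0"
    using low by linarith
  then have "Q z \<inter> {u, v} = {}"
    using finite_Q by simp
  moreover have "v \<in> new z t"
    using new by (cases "v \<in> new z t") auto
  ultimately obtain t' where t': "z < t'" "t' \<le> t" "v \<in> R t'" "v \<notin> Q z" "u \<notin> Q z"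
    by (auto simp: new_def)
  then obtain y where y: "z \<le> y" "y < t'" "u \<in> R y"
    using legal[of v z t' u] assms by auto
  obtain s where s: "z \<le> s" "s \<le> y" "u \<notin> Q s" "\<forall>x. s < x \<and> x \<le> y \<longrightarrow> u \<in> Q x"
    using last_low_time[of "\<lambda>s. u \<notin> Q s" z y] t'(5) y(1) by blast
  have "s \<noteq> y"
    using s(3) y(3) R_subset_Q by auto
  then have "u \<in> new s y"
    using s y by (auto simp: new_def)
  moreover have "1 \<le> 256 * card (Q x \<inter> {u, v})" if "s < x" "x \<le> y" for x
    using s(4) that finite_Q card_0_eq[of "Q x \<inter> {u, v}"]
    by (cases "card (Q x \<inter> {u, v})") auto
  ultimately have "sustained 1 {u, v} {u} s y"
    using s(2) by (auto simp: sustained_def)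
  then show "\<exists>z' t'. z \<le> z' \<and> t' \<le> t \<and> sustained 1 {u, v} {u} z' t'"
    using s y t' by (meson le_trans less_imp_le_nat)
qed

end

section \<open>Long paths in dyadic expanders\<close>

definition block :: "nat \<Rightarrow> nat \<Rightarrow> nat set" where
  "block j b = {b * 2 ^ j..<Suc b * 2 ^ j}"

lemma finite_block [simp]: "finite (block j b)"
  by (simp add: block_def)

lemma card_block [simp]: "card (block j b) = 2 ^ j"
  by (simp add: block_def)

lemma mem_block_iff: "v \<in> block j b \<longleftrightarrow> v div 2 ^ j = b"
  by (auto simp: block_def div_nat_eqI dividend_less_times_div mult.commute
      intro: div_nat_eqI times_div_less_eq_dividend)

lemma div_power2_Suc: "v div 2 ^ Suc j = v div 2 ^ j div (2::nat)"
  by (simp only: power_Suc2 div_mult2_eq)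

lemma block_Suc: "block (Suc j) b = block j (2 * b) \<union> block j (Suc (2 * b))"
  by (auto simp: mem_block_iff div_power2_Suc simp del: power_Suc)

lemma block_disjoint: "b \<noteq> b' \<Longrightarrow> block j b \<inter> block j b' = {}"
  by (auto simp: mem_block_iff)

lemma block_subset_imp_le:
  assumes "block j c \<subseteq> block k b"
  shows "j \<le> k"
proof -
  have "(2::nat) ^ j \<le> 2 ^ k"
    using card_mono[OF finite_block assms] by simp
  then show ?thesis
    by simp
qed

text \<open>\<open>S\<close> is the set of deleted nodes. The blocks range over all natural numbers,
  so paths going to the right meet no boundary.\<close>

locale dyadic_expander =
  fixes par :: "nat \<Rightarrow> nat set" and S :: "nat set"
  assumes expands: "expands par (block j b) (block j (Suc b))"
    and finite_S: "finite S"
begin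

definition edges :: "(nat \<times> nat) set" where
  "edges = {(u, v). u \<in> par v \<and> u \<notin> S \<and> v \<notin> S}"

text \<open>\<open>expands\<close> speaks about parents, but applied to the set \<open>Z\<close> of
  nodes without a parent in \<open>Y\<close> it also controls successors: if \<open>Z\<close> were
  large, its parents would meet \<open>Y\<close>.\<close>

lemma card_succs:
  assumes "Y \<subseteq> block j b - S" "2 ^ j \<le> 128 * card Y"
  shows "127 * 2 ^ j < 128 * card {v \<in> block j (Suc b). \<exists>u\<in>Y. (u, v) \<in> edges} +
           128 * card (S \<inter> block j (Suc b))"
proof -
  define Z where "Z = {v \<in> block j (Suc b). par v \<inter> Y = {}}"
  define X where "X = {v \<in> block j (Suc b). \<exists>u\<in>Y. (u, v) \<in> edges}"
  have Z: "128 * card Z < 2 ^ j"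
  proof (rule ccontr)
    assume "\<not> 128 * card Z < 2 ^ j"
    then have "128 * card (block j b - (\<Union>v\<in>Z. par v)) < 2 ^ j"
      using expands[of j b] unfolding expands_def by (auto simp: Z_def)
    moreover have "card Y \<le> card (block j b - (\<Union>v\<in>Z. par v))"
      using assms(1) by (intro card_mono) (auto simp: Z_def)
    ultimately show False
      using assms(2) by linarith
  qed
  have "card (block j (Suc b)) \<le> card (X \<union> (S \<inter> block j (Suc b)) \<union> Z)"
    using assms(1) by (intro card_mono) (auto simp: X_def Z_def edges_def)
  also have "\<dots> \<le> card X + card (S \<inter> block j (Suc b)) + card Z"
    using card_Un_le[of "X \<union> (S \<inter> block j (Suc b))" Z] card_Un_le[of X "S \<inter> block j (Suc b)"]
    by linarith
  finally show ?thesis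
    using Z unfolding X_def[symmetric] by simp
qed

lemma card_preds:
  assumes "Y \<subseteq> block j (Suc b) - S" "2 ^ j \<le> 128 * card Y"
  shows "127 * 2 ^ j < 128 * card {u \<in> block j b. \<exists>v\<in>Y. (u, v) \<in> edges} +
           128 * card (S \<inter> block j b)"
proof -
  define Z where "Z = block j b - (\<Union>v\<in>Y. par v)"
  define X where "X = {u \<in> block j b. \<exists>v\<in>Y. (u, v) \<in> edges}"
  have Z: "128 * card Z < 2 ^ j"
    using expands[of j b] assms unfolding expands_def Z_def by auto
  have "card (block j b) \<le> card (X \<union> (S \<inter> block j b) \<union> Z)"
    using assms(1) by (intro card_mono) (auto simp: X_def Z_def edges_def)
  also have "\<dots> \<le> card X + card (S \<inter> block j b) + card Z"
    using card_Un_le[of "X \<union> (S \<inter> block j b)" Z] card_Un_le[of X "S \<inter> block j b"]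
    by linarith
  finally show ?thesis
    using Z unfolding X_def[symmetric] by simp
qed

text \<open>With density 1/8, a half of a light block has density at most 1/4. An expansion step
  then still reaches at least \<open>127/128 - 1/4\<close> of that half, which leaves room for the
  invariant 5/8 below; 5/8 exceeds one half, so two such sets in one block intersect.\<close>

definition light :: "nat \<Rightarrow> nat \<Rightarrow> bool" where
  "light j b \<longleftrightarrow> 8 * card (S \<inter> block j b) \<le> 2 ^ j"

text \<open>The neighbouring blocks are included because paths leave the block of \<open>v\<close>
  on both sides. Writing \<open>Suc b\<close> for the left neighbour avoids a truncated
  subtraction.\<close>

definition good :: "nat \<Rightarrow> bool" where
  "good v \<longleftrightarrow> (\<forall>j b. b = v div 2 ^ j \<or> b = Suc (v div 2 ^ j) \<or> Suc b = v div 2 ^ j \<longrightarrow> light j b)"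

lemma light_0: "light 0 b \<Longrightarrow> b \<notin> S"
  by (auto simp: light_def block_def)

lemma light_half:
  assumes "light (Suc j) b" "b' = 2 * b \<or> b' = Suc (2 * b)"
  shows "4 * card (S \<inter> block j b') \<le> 2 ^ j"
proof -
  have "card (S \<inter> block j b') \<le> card (S \<inter> block (Suc j) b)"
    using assms(2) by (intro card_mono) (auto simp: block_Suc)
  then show ?thesis
    using assms(1) by (simp add: light_def)
qed

text \<open>At scale 0 the blocks are single nodes, and an expander between two single nodes is an
  edge.\<close>

lemma edge_Suc:
  assumes "g \<notin> S" "Suc g \<notin> S"
  shows "(g, Suc g) \<in> edges"
proof (rule ccontr)
  assume "(g, Suc g) \<notin> edges"
  then have no_preds: "{u \<in> block 0 g. \<exists>v\<in>{Suc g}. (u, v) \<in> edges} = {}"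
    by (auto simp: block_def)
  show False
    using card_preds[of "{Suc g}" 0 g] assms unfolding no_preds by (simp add: block_def)
qed

text \<open>
  A good node reaches most of the next block at every scale, since most of the next block at one scale
  expands to most of the next block at the following scale; symmetrically for predecessors.
\<close>

definition ahead :: "nat \<Rightarrow> nat \<Rightarrow> nat set" where
  "ahead g j = {v \<in> block j (Suc (g div 2 ^ j)). (g, v) \<in> edges\<^sup>+}"

definition behind :: "nat \<Rightarrow> nat \<Rightarrow> nat set" where
  "behind h j = {u \<in> block j (h div 2 ^ j - 1). (u, h) \<in> edges\<^sup>+}"

lemma trancl_edges_notin: "(u, v) \<in> edges\<^sup>+ \<Longrightarrow> u \<notin> S \<and> v \<notin> S"
  by (induction rule: trancl_induct) (auto simp: edges_def)

lemma finite_ahead [simp]: "finite (ahead g j)" and finite_behind [simp]: "finite (behind g j)"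
  by (auto simp: ahead_def behind_def)

text \<open>If \<open>g\<close> lies in a left half, the next small block is the sibling, and one
  expansion from the common large block reaches the next large block. If \<open>g\<close> lies in a
  right half, the next small block is the left half of the next large block, and one expansion at
  the small scale adds the right half.\<close>

lemma card_ahead:
  assumes "good g"
  shows "5 * 2 ^ j \<le> 8 * card (ahead g j)"
proof (induction j)
  case 0
  have "g \<notin> S" "Suc g \<notin> S"
    using assms light_0 by (force simp: good_def)+
  then have "(g, Suc g) \<in> edges\<^sup>+"
    using edge_Suc by blast
  then have "ahead g 0 = {Suc g}"
    by (auto simp: ahead_def block_def)
  then show ?case
    by simp
next
  case (Suc j)
  define a where "a = g div 2 ^ j"
  have a: "g div 2 ^ Suc j = a div 2"
    by (simp only: a_def div_power2_Suc)
  have light: "light (Suc j) (Suc (a div 2))"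
    using assms unfolding good_def a[symmetric] by blast
  have sub: "ahead g j \<subseteq> block j (Suc a) - S"
    using trancl_edges_notin by (auto simp: ahead_def a_def)
  have step: "{v \<in> block i b. \<exists>u\<in>ahead g j. (u, v) \<in> edges} \<subseteq> {v \<in> block i b. (g, v) \<in> edges\<^sup>+}"
    for i b
    by (auto simp: ahead_def intro: trancl_into_trancl)
  show ?case
  proof (cases "even a")
    case True
    then have "block j (Suc a) \<subseteq> block (Suc j) (a div 2)"
      by (auto simp: block_Suc)
    then have "ahead g j \<subseteq> block (Suc j) (a div 2) - S"
      using sub by blast
    then have "127 * 2 ^ Suc j < 128 * card {v \<in> block (Suc j) (Suc (a div 2)). \<exists>u\<in>ahead g j. (u, v) \<in> edges}
        + 128 * card (S \<inter> block (Suc j) (Suc (a div 2)))"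
      using Suc by (intro card_succs) auto
    moreover have "card {v \<in> block (Suc j) (Suc (a div 2)). \<exists>u\<in>ahead g j. (u, v) \<in> edges}
        \<le> card (ahead g (Suc j))"
      using step unfolding ahead_def[of g "Suc j"] a by (intro card_mono) auto
    ultimately show ?thesis
      using light unfolding light_def by linarith
  next
    case False
    then have Suc_a: "Suc a = 2 * Suc (a div 2)"
      by presburger
    define N where "N = {v \<in> block j (Suc (Suc a)). \<exists>u\<in>ahead g j. (u, v) \<in> edges}"
    have "127 * 2 ^ j < 128 * card N + 128 * card (S \<inter> block j (Suc (Suc a)))"
      using Suc sub unfolding N_def by (intro card_succs) auto
    moreover have "4 * card (S \<inter> block j (Suc (Suc a))) \<le> 2 ^ j"
      using light_half[OF light, of "Suc (Suc a)"] Suc_a by simp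
    moreover have "card (ahead g j) + card N = card (ahead g j \<union> N)"
      using block_disjoint[of "Suc a" "Suc (Suc a)" j] sub
      by (intro card_Un_disjoint[symmetric]) (auto simp: N_def)
    moreover have "card (ahead g j \<union> N) \<le> card (ahead g (Suc j))"
    proof (intro card_mono)
      have "N \<subseteq> {v \<in> block j (Suc (Suc a)). (g, v) \<in> edges\<^sup>+}"
        using step unfolding N_def .
      moreover have "ahead g j \<subseteq> {v \<in> block j (Suc a). (g, v) \<in> edges\<^sup>+}"
        by (simp add: ahead_def a_def)
      ultimately show "ahead g j \<union> N \<subseteq> ahead g (Suc j)"
        unfolding ahead_def[of g "Suc j"] a block_Suc Suc_a[symmetric] by blast
    qed simp
    ultimately show ?thesis
      using Suc by simp
  qed
qed

lemma card_behind:
  assumes "good h" "0 < h div 2 ^ j"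
  shows "5 * 2 ^ j \<le> 8 * card (behind h j)"
  using assms(2)
proof (induction j)
  case 0
  then obtain h' where h': "h = Suc h'"
    by (cases h) auto
  have "h \<notin> S" "h' \<notin> S"
    using assms(1) light_0 h' by (force simp: good_def)+
  then have "(h', h) \<in> edges\<^sup>+"
    using edge_Suc h' by blast
  then have "behind h 0 = {h'}"
    by (auto simp: behind_def block_def h')
  then show ?case
    by simp
next
  case (Suc j)
  define a where "a = h div 2 ^ j"
  have a: "h div 2 ^ Suc j = a div 2"
    by (simp only: a_def div_power2_Suc)
  obtain c where c: "a div 2 = Suc c"
    using Suc.prems unfolding a by (cases "a div 2") auto
  then have IH: "5 * 2 ^ j \<le> 8 * card (behind h j)"
    using Suc.IH by (cases a) (auto simp flip: a_def)
  have light: "light (Suc j) c"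
    using assms(1) c unfolding good_def a[symmetric] by metis
  have sub: "behind h j \<subseteq> block j (a - 1) - S"
    using trancl_edges_notin by (auto simp: behind_def a_def)
  have step: "{u \<in> block i b. \<exists>v\<in>behind h j. (u, v) \<in> edges} \<subseteq> {u \<in> block i b. (u, h) \<in> edges\<^sup>+}"
    for i b
    by (auto simp: behind_def intro: trancl_into_trancl2)
  show ?case
  proof (cases "odd a")
    case True
    then have "a - 1 = 2 * Suc c"
      using c by presburger
    then have "block j (a - 1) \<subseteq> block (Suc j) (Suc c)"
      by (auto simp: block_Suc)
    then have "behind h j \<subseteq> block (Suc j) (Suc c) - S"
      using sub by blast
    then have "127 * 2 ^ Suc j < 128 * card {u \<in> block (Suc j) c. \<exists>v\<in>behind h j. (u, v) \<in> edges}
        + 128 * card (S \<inter> block (Suc j) c)"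
      using IH by (intro card_preds) auto
    moreover have "card {u \<in> block (Suc j) c. \<exists>v\<in>behind h j. (u, v) \<in> edges}
        \<le> card (behind h (Suc j))"
      using step unfolding behind_def[of h "Suc j"] a c by (intro card_mono) auto
    ultimately show ?thesis
      using light unfolding light_def by linarith
  next
    case False
    then have a_eq: "a - 1 = Suc (2 * c)"
      using c by presburger
    then have sub': "behind h j \<subseteq> block j (Suc (2 * c)) - S"
      using sub by metis
    define N where "N = {u \<in> block j (2 * c). \<exists>v\<in>behind h j. (u, v) \<in> edges}"
    have "127 * 2 ^ j < 128 * card N + 128 * card (S \<inter> block j (2 * c))"
      using IH sub' unfolding N_def by (intro card_preds) auto
    moreover have "4 * card (S \<inter> block j (2 * c)) \<le> 2 ^ j"
      using light_half[OF light] by simp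
    moreover have "card (behind h j) + card N = card (behind h j \<union> N)"
      using block_disjoint[of "Suc (2 * c)" "2 * c" j] sub'
      by (intro card_Un_disjoint[symmetric]) (auto simp: N_def)
    moreover have "card (behind h j \<union> N) \<le> card (behind h (Suc j))"
    proof (intro card_mono)
      have "N \<subseteq> {u \<in> block j (2 * c). (u, h) \<in> edges\<^sup>+}"
        using step unfolding N_def .
      moreover have "behind h j \<subseteq> {u \<in> block j (Suc (2 * c)). (u, h) \<in> edges\<^sup>+}"
        unfolding a_eq[symmetric] by (simp add: behind_def a_def)
      ultimately show "behind h j \<union> N \<subseteq> behind h (Suc j)"
        unfolding behind_def[of h "Suc j"] a c block_Suc by auto
    qed simp
    ultimately show ?thesis
      using IH by simp
  qed
qed

text \<open>At the finest scale \<open>j\<close> for which scale \<open>Suc j\<close> brings the two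
  blocks to distance at most 1, the distance is 2 or 3. At distance 2 the nodes reached from
  \<open>g\<close> and those reaching \<open>h\<close> each fill more than half of the middle block,
  so they meet; at distance 3 one more expansion brings them into one block.\<close>

lemma good_connected:
  assumes "good g" "good h" "g < h"
  shows "(g, h) \<in> edges\<^sup>+"
proof (cases "h = Suc g")
  case True
  have "g \<notin> S" "h \<notin> S"
    using assms light_0 by (force simp: good_def)+
  then show ?thesis
    using edge_Suc True by blast
next
  case False
  define dist where "dist = (\<lambda>j. h div 2 ^ j - g div 2 ^ j)"
  have "h < 2 ^ h"
    by (rule less_exp)
  then have "dist h \<le> 1"
    by (simp add: dist_def)
  define j where "j = (LEAST j. dist (Suc j) \<le> 1)"
  have j: "dist (Suc j) \<le> 1"
  proof -
    have "h \<noteq> 0"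
      using assms(3) by simp
    then have "dist (Suc (h - 1)) \<le> 1"
      using \<open>dist h \<le> 1\<close> by simp
    then show ?thesis
      unfolding j_def by (rule LeastI)
  qed
  have dist_j: "2 \<le> dist j"
  proof (cases j)
    case 0
    then show ?thesis
      using assms(3) False by (simp add: dist_def)
  next
    case (Suc i)
    then have "\<not> dist (Suc i) \<le> 1"
      using not_less_Least[of i "\<lambda>j. dist (Suc j) \<le> 1"] unfolding j_def[symmetric] by simp
    then show ?thesis
      using Suc by simp
  qed
  define a where "a = g div 2 ^ j"
  define b where "b = h div 2 ^ j"
  have "b div 2 - a div 2 \<le> 1"
    using j by (simp add: dist_def a_def b_def div_power2_Suc del: power_Suc)
  then have b: "b = Suc (Suc a) \<or> b = Suc (Suc (Suc a))"
    using dist_j unfolding dist_def a_def[symmetric] b_def[symmetric] by presburger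
  have ahead: "5 * 2 ^ j \<le> 8 * card (ahead g j)"
    using card_ahead[OF assms(1)] .
  have behind: "5 * 2 ^ j \<le> 8 * card (behind h j)"
    using card_behind[OF assms(2)] b unfolding b_def by auto
  have sub: "ahead g j \<subseteq> block j (Suc a) - S" "behind h j \<subseteq> block j (b - 1) - S"
    using trancl_edges_notin by (auto simp: ahead_def behind_def a_def b_def)
  have "\<exists>u v. u \<in> ahead g j \<and> v \<in> behind h j \<and> (u, v) \<in> edges\<^sup>*"
    using b
  proof
    assume "b = Suc (Suc a)"
    then have "card (ahead g j \<union> behind h j) \<le> card (block j (Suc a))"
      using sub by (intro card_mono) auto
    then have "card (ahead g j \<union> behind h j) \<le> 2 ^ j"
      by simp
    moreover have "(0::nat) < 2 ^ j"
      by simp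
    ultimately have "card (ahead g j \<union> behind h j) \<noteq> card (ahead g j) + card (behind h j)"
      using ahead behind by linarith
    then have "ahead g j \<inter> behind h j \<noteq> {}"
      using card_Un_disjoint[OF finite_ahead finite_behind] by blast
    then show ?thesis
      by blast
  next
    assume b: "b = Suc (Suc (Suc a))"
    define N where "N = {v \<in> block j (Suc (Suc a)). \<exists>u\<in>ahead g j. (u, v) \<in> edges}"
    have "127 * 2 ^ j < 128 * card N + 128 * card (S \<inter> block j (Suc (Suc a)))"
      using ahead sub unfolding N_def by (intro card_succs) auto
    moreover have "light j (Suc (Suc a))"
      using assms(2) b unfolding good_def b_def by metis
    moreover have "card (N \<union> behind h j) \<le> card (block j (Suc (Suc a)))"
      using sub b by (intro card_mono) (auto simp: N_def)
    then have "card (N \<union> behind h j) \<le> 2 ^ j"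
      by simp
    ultimately have "card (N \<union> behind h j) \<noteq> card N + card (behind h j)"
      using behind unfolding light_def by linarith
    moreover have "finite N"
      by (simp add: N_def)
    ultimately have "N \<inter> behind h j \<noteq> {}"
      using card_Un_disjoint[OF _ finite_behind] by blast
    then show ?thesis
      by (auto simp: N_def)
  qed
  then show ?thesis
    by (auto simp: ahead_def behind_def)
qed

text \<open>\<open>F\<close> consists of maximal heavy blocks, found from the top: a heavy block
  covers all blocks inside it, while a light one is split into its halves. A heavy block at scale
  \<open>j\<close> has more than \<open>2 ^ j / 8\<close> deleted nodes, and disjointness counts
  each of them once.\<close>

lemma heavy_cover:
  "\<exists>F. finite F \<and> (\<Sum>(j, c)\<in>F. 2 ^ j) \<le> 8 * card (S \<inter> block k b) \<and>
     (\<forall>j c. \<not> light j c \<longrightarrow> block j c \<subseteq> block k b \<longrightarrow>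
        (\<exists>(j', c')\<in>F. j \<le> j' \<and> block j c \<subseteq> block j' c'))"
proof (induction k arbitrary: b)
  case 0
  show ?case
  proof (cases "light 0 b")
    case True
    have "light j c" if "block j c \<subseteq> block 0 b" for j c
    proof -
      have "j = 0"
        using block_subset_imp_le[OF that] by simp
      moreover from this have "c = b"
        using that by (simp add: block_def)
      ultimately show ?thesis
        using True by simp
    qed
    then show ?thesis
      by (intro exI[of _ "{}"]) auto
  next
    case False
    have "j = 0" if "block j c \<subseteq> block 0 b" for j c
      using block_subset_imp_le[OF that] by simp
    then show ?thesis
      using False by (intro exI[of _ "{(0, b)}"]) (auto simp: light_def)
  qed
next
  case (Suc k)
  show ?case
  proof (cases "light (Suc k) b")
    case False
    then show ?thesis
      using block_subset_imp_le[of _ _ "Suc k" b] by (intro exI[of _ "{(Suc k, b)}"]) (auto simp: light_def)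
  next
    case True
    obtain F1 where F1: "finite F1" "(\<Sum>(j, c)\<in>F1. 2 ^ j) \<le> 8 * card (S \<inter> block k (2 * b))"
      "\<And>j c. \<not> light j c \<Longrightarrow> block j c \<subseteq> block k (2 * b) \<Longrightarrow>
        (\<exists>(j', c')\<in>F1. j \<le> j' \<and> block j c \<subseteq> block j' c')"
      using Suc.IH[of "2 * b"] by blast
    obtain F2 where F2: "finite F2" "(\<Sum>(j, c)\<in>F2. 2 ^ j) \<le> 8 * card (S \<inter> block k (Suc (2 * b)))"
      "\<And>j c. \<not> light j c \<Longrightarrow> block j c \<subseteq> block k (Suc (2 * b)) \<Longrightarrow>
        (\<exists>(j', c')\<in>F2. j \<le> j' \<and> block j c \<subseteq> block j' c')"
      using Suc.IH[of "Suc (2 * b)"] by blast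
    have halves: "block j c \<subseteq> block k (2 * b) \<or> block j c \<subseteq> block k (Suc (2 * b))"
      if "\<not> light j c" "block j c \<subseteq> block (Suc k) b" for j c
    proof -
      have "j \<le> Suc k"
        using block_subset_imp_le[OF that(2)] .
      moreover have "j \<noteq> Suc k"
      proof
        assume "j = Suc k"
        then have "c * 2 ^ Suc k \<in> block (Suc k) b"
          using that(2) by (auto simp: block_def)
        then have "c = b"
          by (simp add: mem_block_iff)
        then show False
          using True that(1) \<open>j = Suc k\<close> by simp
      qed
      ultimately have "j \<le> k"
        by simp
      then have "v div 2 ^ k = c div 2 ^ (k - j)" if "v \<in> block j c" for v
        using that by (auto simp: mem_block_iff div_mult2_eq[symmetric] simp flip: power_add)
      then have "block j c \<subseteq> block k (c div 2 ^ (k - j))"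
        by (auto simp: mem_block_iff)
      moreover have "c * 2 ^ j \<in> block j c"
        by (simp add: block_def)
      then have "c * 2 ^ j \<in> block k (c div 2 ^ (k - j))"
          "c * 2 ^ j \<in> block k (2 * b) \<union> block k (Suc (2 * b))"
        using calculation that(2) unfolding block_Suc by blast+
      then have "c div 2 ^ (k - j) = 2 * b \<or> c div 2 ^ (k - j) = Suc (2 * b)"
        unfolding Un_iff mem_block_iff by metis
      ultimately show ?thesis
        by metis
    qed
    have "(\<Sum>(j, c)\<in>F1 \<union> F2. 2 ^ j) \<le> (\<Sum>(j, c)\<in>F1. 2 ^ j) + (\<Sum>(j, c)\<in>F2. (2 ^ j :: nat))"
      using sum.union_inter[OF F1(1) F2(1), of "\<lambda>(j, c). 2 ^ j :: nat"] by linarith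
    also have "\<dots> \<le> 8 * (card (S \<inter> block k (2 * b)) + card (S \<inter> block k (Suc (2 * b))))"
      unfolding distrib_left using F1(2) F2(2) by (rule add_mono)
    also have "card (S \<inter> block k (2 * b)) + card (S \<inter> block k (Suc (2 * b)))
        = card ((S \<inter> block k (2 * b)) \<union> (S \<inter> block k (Suc (2 * b))))"
      using block_disjoint[of "2 * b" "Suc (2 * b)" k]
      by (intro card_Un_disjoint[symmetric]) auto
    also have "\<dots> = card (S \<inter> block (Suc k) b)"
      by (simp add: block_Suc Int_Un_distrib)
    finally have "(\<Sum>(j, c)\<in>F1 \<union> F2. 2 ^ j) \<le> 8 * card (S \<inter> block (Suc k) b)" .
    moreover have "\<exists>(j', c')\<in>F1 \<union> F2. j \<le> j' \<and> block j c \<subseteq> block j' c'"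
      if "\<not> light j c" "block j c \<subseteq> block (Suc k) b" for j c
      using halves[OF that] F1(3)[OF that(1)] F2(3)[OF that(1)] by blast
    moreover have "finite (F1 \<union> F2)"
      using F1(1) F2(1) by simp
    ultimately show ?thesis
      by blast
  qed
qed

text \<open>A bad node lies in a heavy block or next to one. Passing to a coarser scale keeps blocks
  equal or adjacent, so the node lies in a maximal heavy block or in one of its two neighbours:
  \<open>24 = 3 * 8\<close>.\<close>

lemma card_not_good:
  assumes S: "S \<subseteq> {..<2 ^ k}" "64 * card S \<le> 2 ^ k"
  shows "card {v. \<not> good v} \<le> 24 * card S" "finite {v. \<not> good v}"
proof -
  have block_k: "block k 0 = {..<2 ^ k}"
    by (auto simp: block_def)
  obtain F where F: "finite F" "(\<Sum>(j, c)\<in>F. 2 ^ j) \<le> 8 * card (S \<inter> block k 0)"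
      "\<And>j c. \<not> light j c \<Longrightarrow> block j c \<subseteq> block k 0 \<Longrightarrow>
        (\<exists>(j', c')\<in>F. j \<le> j' \<and> block j c \<subseteq> block j' c')"
    using heavy_cover[of k 0] by blast
  define triple where "triple = (\<lambda>(j, c). block j (c - 1) \<union> block j c \<union> block j (Suc c))"
  have sub: "{v. \<not> good v} \<subseteq> (\<Union>jc\<in>F. triple jc)"
  proof
    fix v assume "v \<in> {v. \<not> good v}"
    then obtain j b where jb: "\<not> light j b"
        "b = v div 2 ^ j \<or> b = Suc (v div 2 ^ j) \<or> Suc b = v div 2 ^ j"
      by (auto simp: good_def)
    \<comment> \<open>\<open>S\<close> is too small to make a block of size \<open>2 ^ k\<close> or
      more heavy. A heavy block is therefore smaller, and as it meets \<open>S\<close> it lies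
      inside \<open>block k 0\<close>.\<close>
    have "card (S \<inter> block j b) \<le> card S"
      using finite_S by (intro card_mono) auto
    then have "(2::nat) ^ j < 2 ^ k"
      using jb(1) S(2) unfolding light_def by linarith
    then have "j < k"
      using power_less_imp_less_exp[of 2 j k] by simp
    have "S \<inter> block j b \<noteq> {}"
      using jb(1) by (auto simp: light_def)
    then obtain x where "x \<in> S" "x \<in> block j b"
      by blast
    then have x: "x \<in> S" "x div 2 ^ j = b"
      by (simp_all only: mem_block_iff)
    then have "x < 2 ^ k"
      using S(1) by auto
    have nested: "y div 2 ^ i = y div 2 ^ j div 2 ^ (i - j)" if "j \<le> i" for y i :: nat
      using that by (simp add: div_mult2_eq[symmetric] flip: power_add)
    have "block j b \<subseteq> block k 0"
    proof
      fix y assume "y \<in> block j b"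
      then have "y div 2 ^ k = x div 2 ^ k"
        using x \<open>j < k\<close> nested[of k] by (metis less_imp_le mem_block_iff)
      then show "y \<in> block k 0"
        using \<open>x < 2 ^ k\<close> by (simp add: mem_block_iff)
    qed
    then obtain j' c' where jc': "(j', c') \<in> F" "j \<le> j'" "block j b \<subseteq> block j' c'"
      using F(3)[OF jb(1)] by blast
    have "x \<in> block j' c'"
      using x jc'(3) by (auto simp: mem_block_iff)
    then have c': "c' = b div 2 ^ (j' - j)"
      using nested[OF jc'(2), of x] x by (simp add: mem_block_iff)
    define r :: nat where "r = 2 ^ (j' - j)"
    have "0 < r"
      by (simp add: r_def)
    then have Suc_div: "Suc y div r = y div r \<or> Suc y div r = Suc (y div r)" for y
      by (simp add: div_Suc)
    have "v div 2 ^ j' = v div 2 ^ j div r"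
      using nested[OF jc'(2), of v] by (simp add: r_def)
    moreover have "c' = b div r"
      by (simp add: c' r_def)
    ultimately have "v div 2 ^ j' = c' \<or> v div 2 ^ j' = c' - 1 \<or> v div 2 ^ j' = Suc c'"
      using jb(2) Suc_div[of "v div 2 ^ j"] Suc_div[of b] by auto
    then have "v \<in> triple (j', c')"
      by (auto simp: triple_def mem_block_iff)
    then show "v \<in> (\<Union>jc\<in>F. triple jc)"
      using jc'(1) by blast
  qed
  have fin: "finite (\<Union>jc\<in>F. triple jc)"
    using F(1) by (auto simp: triple_def)
  then show "finite {v. \<not> good v}"
    using sub finite_subset by blast
  have "card {v. \<not> good v} \<le> card (\<Union>jc\<in>F. triple jc)"
    using sub fin by (rule card_mono[rotated])
  also have "\<dots> \<le> (\<Sum>jc\<in>F. card (triple jc))"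
    by (rule card_UN_le[OF F(1)])
  also have "\<dots> \<le> (\<Sum>(j, c)\<in>F. 3 * 2 ^ j)"
  proof (intro sum_mono)
    fix jc :: "nat \<times> nat"
    obtain j c where jc: "jc = (j, c)"
      by force
    have "card (triple jc) \<le> card (block j (c - 1)) + card (block j c) + card (block j (Suc c))"
      using card_Un_le[of "block j (c - 1) \<union> block j c" "block j (Suc c)"]
        card_Un_le[of "block j (c - 1)" "block j c"]
      unfolding jc triple_def prod.case by linarith
    then show "card (triple jc) \<le> (case jc of (j, c) \<Rightarrow> 3 * 2 ^ j)"
      by (simp add: jc)
  qed
  also have "\<dots> = 3 * (\<Sum>(j, c)\<in>F. 2 ^ j)"
    by (simp add: sum_distrib_left case_prod_unfold)
  also have "\<dots> \<le> 3 * (8 * card (S \<inter> block k 0))"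
    using F(2) by simp
  also have "S \<inter> block k 0 = S"
    using S(1) by (auto simp: block_k)
  finally show "card {v. \<not> good v} \<le> 24 * card S"
    by simp
qed

end

lemma iterated_gap:
  fixes W :: "nat set" and f :: "nat \<Rightarrow> nat"
  assumes "finite W" "W \<noteq> {}" "\<And>g h. g \<in> W \<Longrightarrow> h \<in> W \<Longrightarrow> g < h \<Longrightarrow> f g + K \<le> f h"
  shows "(card W - 1) * K + f (Min W) \<le> f (Max W)"
  using assms
proof (induction W rule: finite_linorder_max_induct)
  case (insert b A)
  show ?case
  proof (cases "A = {}")
    case False
    have "(card A - 1) * K + f (Min A) \<le> f (Max A)"
      using insert False by auto
    moreover have "f (Max A) + K \<le> f b"
      using insert False by auto
    moreover have "card A \<noteq> 0"
      using insert False by auto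
    moreover have "Max (insert b A) = b"
      using insert by (intro Max_eqI) auto
    moreover have "Min A < b"
      using insert False Min_in by blast
    then have "Min (insert b A) = Min A"
      using insert False by simp
    moreover have "card (insert b A) - 1 = card A"
      using insert by auto
    ultimately show ?thesis
      by (cases "card A") (auto simp: algebra_simps)
  qed simp
qed simp

section \<open>The graph\<close>

datatype node = Src nat nat | Snk nat nat

text \<open>A \<open>dag\<close> has natural numbers as vertices, so structured vertices are encoded
  by \<open>to_nat\<close>.\<close>

instance node :: countable
  by countable_datatype

locale pebble_graph =
  fixes D k :: nat and E :: "nat \<Rightarrow> nat \<Rightarrow> nat \<Rightarrow> nat \<Rightarrow> nat"
  assumes expander: "\<lbrakk>0 < p; 0 < q; p \<le> 2 * q\<rbrakk> \<Longrightarrow> is_expander D p q (E p q)"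
begin

text \<open>\<open>x mod 2 ^ j\<close> is the position of \<open>x\<close> in its block of size
  \<open>2 ^ j\<close>. The same function serves the edges inside a copy, between a copy and its
  halves, and between adjacent blocks.\<close>

definition nbrs :: "nat \<Rightarrow> nat \<Rightarrow> nat \<Rightarrow> nat \<Rightarrow> nat list" where
  "nbrs i a j x = map (\<lambda>d. a * 2 ^ i + E (2 ^ i) (2 ^ j) (x mod 2 ^ j) d) [0..<D]"

lemma length_nbrs [simp]: "length (nbrs i a j x) = D"
  by (simp add: nbrs_def)

lemma nbrs_subset_block:
  assumes "i \<le> Suc j"
  shows "set (nbrs i a j x) \<subseteq> block i a"
proof -
  have "(2::nat) ^ i \<le> 2 ^ Suc j"
    using assms by (intro power_increasing) auto
  then have "E (2 ^ i) (2 ^ j) (x mod 2 ^ j) d < 2 ^ i" if "d < D" for d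
    using expander[of "2 ^ i" "2 ^ j"] that unfolding is_expander_def by simp
  then show ?thesis
    by (auto simp: nbrs_def block_def)
qed

lemma nbrs_cover:
  assumes "i \<le> Suc j" "Y \<subseteq> block j b" "2 ^ j \<le> 128 * card Y"
  shows "128 * card (block i a - (\<Union>x\<in>Y. set (nbrs i a j x))) < 2 ^ i"
proof (rule ccontr)
  define X where "X = block i a - (\<Union>x\<in>Y. set (nbrs i a j x))"
  assume "\<not> 128 * card (block i a - (\<Union>x\<in>Y. set (nbrs i a j x))) < 2 ^ i"
  then have X: "2 ^ i \<le> 128 * card X"
    by (simp add: X_def)
  have "(2::nat) ^ i \<le> 2 ^ Suc j"
    using assms(1) by (intro power_increasing) auto
  then have exp: "is_expander D (2 ^ i) (2 ^ j) (E (2 ^ i) (2 ^ j))"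
    using expander[of "2 ^ i" "2 ^ j"] by simp
  define A where "A = (\<lambda>u. u mod 2 ^ i) ` X"
  define B where "B = (\<lambda>x. x mod 2 ^ j) ` Y"
  have inj: "inj_on (\<lambda>u. u mod 2 ^ l) (block l c)" for l c
    by (rule inj_onI) (metis div_mult_mod_eq mem_block_iff)
  have "card A = card X"
    unfolding A_def using inj by (intro card_image) (auto simp: X_def inj_on_def)
  moreover have "card B = card Y"
    unfolding B_def using inj assms(2) by (intro card_image) (auto intro: inj_on_subset)
  moreover have "A \<subseteq> {..<2 ^ i}" "B \<subseteq> {..<2 ^ j}"
    by (auto simp: A_def B_def)
  ultimately have "\<exists>b\<in>B. \<exists>d<D. E (2 ^ i) (2 ^ j) b d \<in> A"
    using exp X assms(3) unfolding is_expander_def by simp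
  then obtain x d where x: "x \<in> Y" "d < D" "E (2 ^ i) (2 ^ j) (x mod 2 ^ j) d \<in> A"
    unfolding B_def by blast
  then obtain u where u: "u \<in> X" "E (2 ^ i) (2 ^ j) (x mod 2 ^ j) d = u mod 2 ^ i"
    by (auto simp: A_def)
  have "u div 2 ^ i = a"
    using u(1) by (auto simp: X_def mem_block_iff)
  then have "u = a * 2 ^ i + E (2 ^ i) (2 ^ j) (x mod 2 ^ j) d"
    using u(2) div_mult_mod_eq[of u "2 ^ i"] by simp
  then have "u \<in> set (nbrs i a j x)"
    using x(2) by (auto simp: nbrs_def)
  then show False
    using u(1) x(1) by (auto simp: X_def)
qed

text \<open>Additional parents only help, so an inclusion suffices. The labellings \<open>g\<close>
  and \<open>h\<close> will be \<open>Src i\<close>, \<open>Snk i\<close> or the identity.\<close>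

lemma expands_nbrs:
  assumes "i \<le> Suc j" "inj g" "inj h"
    and sub: "\<And>x. x \<in> block j b \<Longrightarrow> g ` set (nbrs i a j x) \<subseteq> par (h x)"
  shows "expands par (g ` block i a) (h ` block j b)"
  unfolding expands_def
proof (intro allI impI)
  fix Y assume Y: "Y \<subseteq> h ` block j b" "card (h ` block j b) \<le> 128 * card Y"
  then obtain Y' where Y': "Y' \<subseteq> block j b" "Y = h ` Y'"
    by (meson subset_imageE)
  have "card Y = card Y'"
    using Y'(2) assms(3) by (simp add: card_image inj_on_subset)
  moreover have "card (h ` block j b) = 2 ^ j"
    using assms(3) by (simp add: card_image inj_on_subset)
  ultimately have "128 * card (block i a - (\<Union>x\<in>Y'. set (nbrs i a j x))) < 2 ^ i"
    using nbrs_cover[OF assms(1) Y'(1)] Y(2) by simp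
  moreover have "g ` block i a - (\<Union>y\<in>Y. par y) \<subseteq> g ` (block i a - (\<Union>x\<in>Y'. set (nbrs i a j x)))"
    using sub Y' by fastforce
  then have "card (g ` block i a - (\<Union>y\<in>Y. par y))
      \<le> card (g ` (block i a - (\<Union>x\<in>Y'. set (nbrs i a j x))))"
    by (intro card_mono) auto
  then have "card (g ` block i a - (\<Union>y\<in>Y. par y))
      \<le> card (block i a - (\<Union>x\<in>Y'. set (nbrs i a j x)))"
    using card_image_le[of "block i a - (\<Union>x\<in>Y'. set (nbrs i a j x))" g] by simp
  moreover have "card (g ` block i a) = 2 ^ i"
    using assms(2) by (simp add: card_image inj_on_subset)
  ultimately show "128 * card (g ` block i a - (\<Union>y\<in>Y. par y)) < card (g ` block i a)"
    by linarith
qed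

text \<open>
  All copies of the recursive graph of level i share the index range {..<2^k}: the sources and sinks of
  copy c are Src i x and Snk i x with x in block i c, and its two halves are the copies 2c and 2c + 1 of
  level i - 1. The top sources Src k x carry the depth-robust graph.
\<close>

fun plist :: "node \<Rightarrow> node list" where
  "plist (Snk 0 x) = [Src 0 x]"
| "plist (Snk (Suc i) x) =
     map (Src (Suc i)) (nbrs (Suc i) (x div 2 ^ Suc i) (Suc i) x) @
     map (Snk i) (nbrs i (Suc (2 * (x div 2 ^ Suc i))) (Suc i) x)"
| "plist (Src i x) =
     (if i < k then
        map (Src (Suc i)) (nbrs (Suc i) (x div 2 ^ Suc i) i x) @
        (if odd (x div 2 ^ i) then map (Snk i) (nbrs i (x div 2 ^ i - 1) i x) else [])
      else
        concat (map (\<lambda>j. if x div 2 ^ j = 0 then [] else map (Src i) (nbrs j (x div 2 ^ j - 1) j x))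
          [0..<k]))"

abbreviation par :: "node \<Rightarrow> node set" where
  "par v \<equiv> set (plist v)"

definition copy :: "nat \<Rightarrow> nat \<Rightarrow> node set" where
  "copy i c = (\<Union>j\<le>i. Src j ` block i c \<union> Snk j ` block i c)"

lemma finite_copy [simp]: "finite (copy i c)"
  by (simp add: copy_def)

lemma Src_in_copy [simp]: "Src j x \<in> copy i c \<longleftrightarrow> j \<le> i \<and> x \<in> block i c"
  and Snk_in_copy [simp]: "Snk j x \<in> copy i c \<longleftrightarrow> j \<le> i \<and> x \<in> block i c"
  by (auto simp: copy_def)

lemma copy_Suc_subset: "copy i (2 * c) \<subseteq> copy (Suc i) c" "copy i (Suc (2 * c)) \<subseteq> copy (Suc i) c"
proof -
  have "v \<in> copy (Suc i) c" if "v \<in> copy i (2 * c) \<or> v \<in> copy i (Suc (2 * c))" for v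
    using that by (cases v) (auto simp: block_Suc)
  then show "copy i (2 * c) \<subseteq> copy (Suc i) c" "copy i (Suc (2 * c)) \<subseteq> copy (Suc i) c"
    by blast+
qed

lemma inj_Src [simp]: "inj (Src i)" and inj_Snk [simp]: "inj (Snk i)"
  by (auto intro: injI)

lemma card_Src_block [simp]: "card (Src i ` block j b) = 2 ^ j"
  and card_Snk_block [simp]: "card (Snk i ` block j b) = 2 ^ j"
  by (simp_all add: card_image inj_on_def)

text \<open>The doubling step asks nothing of the parents of the outer sources \<open>S\<close>;
  this leaves the sources of level \<open>k\<close> free to carry the depth-robust graph.\<close>

lemma robust_copy:
  assumes "coarse_pebbling par Q R" "i \<le> k"
  shows "coarse_pebbling.robust Q R (2 ^ i) (copy i c) (Src i ` block i c) (Snk i ` block i c)"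
  using assms(2)
proof (induction i arbitrary: c)
  case 0
  have "copy 0 c = {Src 0 c, Snk 0 c}"
    by (auto simp: copy_def block_def)
  then show ?case
    using coarse_pebbling.robust_pair[OF assms(1), of "Snk 0 c" "Src 0 c"] by (simp add: block_def)
next
  case (Suc i)
  have mem: "x div 2 ^ Suc i = c" if "x \<in> block i (2 * c) \<or> x \<in> block i (Suc (2 * c))" for x
    using that by (auto simp: mem_block_iff div_power2_Suc simp del: power_Suc)
  have "coarse_pebbling.robust Q R (2 * 2 ^ i) (copy (Suc i) c) (Src (Suc i) ` block (Suc i) c)
     (Snk (Suc i) ` block (Suc i) c)"
  proof (rule coarse_pebbling.robust_double[OF assms(1), where ?V1.0 = "copy i (2 * c)" and
        ?S1.0 = "Src i ` block i (2 * c)" and ?T1.0 = "Snk i ` block i (2 * c)" and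
        ?V2.0 = "copy i (Suc (2 * c))" and
        ?S2.0 = "Src i ` block i (Suc (2 * c))" and ?T2.0 = "Snk i ` block i (Suc (2 * c))"])
    show "copy i (2 * c) \<inter> copy i (Suc (2 * c)) = {}"
      using block_disjoint[of "2 * c" "Suc (2 * c)" i] by (auto simp: copy_def)
    show "expands par (Src (Suc i) ` block (Suc i) c) (Snk (Suc i) ` block (Suc i) c)"
      "expands par (Snk i ` block i (Suc (2 * c))) (Snk (Suc i) ` block (Suc i) c)"
      by (rule expands_nbrs; auto simp: mem_block_iff simp del: power_Suc)+
    show "expands par (Src (Suc i) ` block (Suc i) c) (Src i ` block i (Suc (2 * c)))"
      "expands par (Src (Suc i) ` block (Suc i) c) (Src i ` block i (2 * c))"
      using Suc.prems mem by (auto intro!: expands_nbrs simp del: power_Suc)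
    show "expands par (Snk i ` block i (2 * c)) (Src i ` block i (Suc (2 * c)))"
      using Suc.prems by (intro expands_nbrs) (auto simp: mem_block_iff simp del: power_Suc)
  qed (use Suc copy_Suc_subset in \<open>auto\<close>)
  then show ?case
    by simp
qed

text \<open>The depth-robust graph on bare indices, without the cutoff at scale \<open>k\<close>, so
  that adjacent blocks are joined on all natural numbers. Below \<open>2 ^ k\<close> the scales from
  \<open>k\<close> on contribute nothing.\<close>

definition lpar :: "nat \<Rightarrow> nat set" where
  "lpar x = (\<Union>j\<in>{j. x div 2 ^ j \<noteq> 0}. set (nbrs j (x div 2 ^ j - 1) j x))"

lemma expands_lpar: "expands lpar (block j b) (block j (Suc b))"
proof -
  have "expands lpar ((\<lambda>x. x) ` block j b) ((\<lambda>x. x) ` block j (Suc b))"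
  proof (rule expands_nbrs)
    fix x assume "x \<in> block j (Suc b)"
    then have "x div 2 ^ j = Suc b"
      by (simp add: mem_block_iff)
    then have j: "j \<in> {j. x div 2 ^ j \<noteq> 0}" and nbrs_eq: "nbrs j b j x = nbrs j (x div 2 ^ j - 1) j x"
      by simp_all
    from j have "set (nbrs j (x div 2 ^ j - 1) j x) \<subseteq> lpar x"
      unfolding lpar_def by (rule UN_upper)
    then show "(\<lambda>x. x) ` set (nbrs j b j x) \<subseteq> lpar x"
      unfolding nbrs_eq image_ident .
  qed auto
  then show ?thesis
    by simp
qed

lemma div_power2_eq_0: "x < 2 ^ k \<Longrightarrow> k \<le> j \<Longrightarrow> x div 2 ^ j = (0::nat)"
  by (meson div_less le_trans less_le_trans one_le_numeral power_increasing)

lemma par_Src_top: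
  assumes "x < 2 ^ k"
  shows "par (Src k x) = Src k ` lpar x"
proof -
  have "j < k" if "x div 2 ^ j \<noteq> 0" for j
    using div_power2_eq_0[OF assms, of j] that by (cases "j < k") auto
  then have "{j. x div 2 ^ j \<noteq> 0} = {j \<in> {0..<k}. x div 2 ^ j \<noteq> 0}"
    by auto
  then show ?thesis
    by (auto simp: lpar_def)
qed

lemma lpar_less:
  assumes "y \<in> lpar x"
  shows "y < x"
proof -
  obtain j where j: "x div 2 ^ j \<noteq> 0" "y \<in> set (nbrs j (x div 2 ^ j - 1) j x)"
    using assms unfolding lpar_def by blast
  then have "y \<in> block j (x div 2 ^ j - 1)"
    using nbrs_subset_block[of j j "x div 2 ^ j - 1" x] by auto
  with j(1) have "y div 2 ^ j < x div 2 ^ j"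
    by (simp add: mem_block_iff)
  then show ?thesis
    by (meson div_le_mono not_le)
qed

lemma block_top: "block k 0 = {..<2 ^ k}"
  by (auto simp: block_def)

abbreviation nodes :: "node set" where
  "nodes \<equiv> copy k 0"

text \<open>
  Topological order: a copy occupies the time slot given by its block, its sources come at the left end
  (larger copies first) and its sinks at the right end (larger copies last).
\<close>

fun rk :: "node \<Rightarrow> nat" where
  "rk (Src i x) =
     (if i < k then 2 ^ k + k + 1 + x div 2 ^ i * 2 ^ i * (2 * k + 3) + (k - i) else x)"
| "rk (Snk i x) = 2 ^ k + Suc (x div 2 ^ i) * 2 ^ i * (2 * k + 3) + i"

text \<open>At a slot boundary the offsets up to \<open>k\<close> belong to sinks of copies ending
  there, and larger ones, at most \<open>2 * k + 1\<close>, to sources of copies starting there.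
  Hence the shift \<open>k + 1\<close> and the slot width \<open>2 * k + 3\<close>; the ranks below
  \<open>2 ^ k\<close> are left to the top sources.\<close>

lemma par_rk:
  assumes "v \<in> nodes" "u \<in> par v"
  shows "u \<in> nodes \<and> rk u < rk v"
proof -
  have less_top: "y < 2 ^ k" if "y \<in> block i c" "c \<le> x div 2 ^ i" "x < 2 ^ k" "i \<le> k" for x y i c
  proof -
    have "y div 2 ^ i \<le> x div 2 ^ i"
      using that by (simp add: mem_block_iff)
    then have "y div 2 ^ i div 2 ^ (k - i) \<le> x div 2 ^ i div 2 ^ (k - i)"
      by (rule div_le_mono)
    then have "y div 2 ^ k \<le> x div 2 ^ k"
      using that(4) by (simp add: div_mult2_eq[symmetric] flip: power_add)
    then have "y div 2 ^ k = 0"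
      using that(3) by simp
    then show ?thesis
      by (simp add: div_eq_0_iff)
  qed
  show ?thesis
  proof (cases v rule: plist.cases)
    case (1 x)
    then show ?thesis
      using assms by (auto simp: block_top)
  next
    case (2 i x)
    then have x: "x < 2 ^ k" "Suc i \<le> k"
      using assms(1) by (auto simp: block_top)
    define c where "c = x div 2 ^ Suc i"
    consider y where "u = Src (Suc i) y" "y \<in> block (Suc i) c"
      | y where "u = Snk i y" "y \<in> block i (Suc (2 * c))"
      using assms(2) nbrs_subset_block[of "Suc i" "Suc i" c x]
        nbrs_subset_block[of i "Suc i" "Suc (2 * c)" x] unfolding 2 c_def by auto
    then show ?thesis
    proof cases
      case 1
      have y: "y < 2 ^ k"
        using less_top[OF 1(2) _ x] by (simp add: c_def)
      have rk_v: "rk v = 2 ^ k + c * 2 ^ Suc i * (2 * k + 3) + 2 ^ Suc i * (2 * k + 3) + Suc i"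
        unfolding 2 rk.simps c_def[symmetric] by (simp only: mult_Suc distrib_right)
      have "rk u \<le> 2 ^ k + k + 1 + c * 2 ^ Suc i * (2 * k + 3) + k"
        using 1(2) y unfolding 1(1) rk.simps mem_block_iff
        by (cases "Suc i < k") (auto simp del: power_Suc)
      moreover have "2 * k + 3 \<le> 2 ^ Suc i * (2 * k + 3)"
        by simp
      ultimately have "rk u < rk v"
        unfolding rk_v by linarith
      then show ?thesis
        using y x 1(1) by (simp add: block_top)
    next
      case 2
      then have "y \<in> block (Suc i) c"
        by (simp add: block_Suc)
      then have y: "y < 2 ^ k"
        using less_top[OF _ _ x] by (simp add: c_def)
      have "rk u = 2 ^ k + Suc c * 2 ^ Suc i * (2 * k + 3) + i"
        using 2 mem_block_iff[of y i "Suc (2 * c)"] by simp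
      moreover have "rk v = 2 ^ k + Suc c * 2 ^ Suc i * (2 * k + 3) + Suc i"
        unfolding \<open>v = _\<close> rk.simps c_def[symmetric] ..
      ultimately show ?thesis
        using y x 2(1) by (simp add: block_top)
    qed
  next
    case (3 i x)
    then have x: "x < 2 ^ k" "i \<le> k"
      using assms(1) by (auto simp: block_top)
    show ?thesis
    proof (cases "i < k")
      case False
      then have "i = k"
        using x by simp
      then obtain y where "u = Src k y" "y \<in> lpar x"
        using assms(2) par_Src_top[OF x(1)] 3 by auto
      then show ?thesis
        using lpar_less[of y x] x 3 \<open>i = k\<close> by (auto simp: block_top)
    next
      case True
      define b where "b = x div 2 ^ i"
      have b2: "x div 2 ^ Suc i = b div 2"
        by (simp only: b_def div_power2_Suc)
      consider y where "u = Src (Suc i) y" "y \<in> block (Suc i) (b div 2)"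
        | y where "u = Snk i y" "y \<in> block i (b - 1)" "odd b"
        using assms(2) True nbrs_subset_block[of "Suc i" i "b div 2" x]
          nbrs_subset_block[of i i "b - 1" x]
        unfolding 3 by (auto simp: b2 simp flip: b_def simp del: power_Suc split: if_splits)
      then show ?thesis
      proof cases
        case 1
        have y: "y < 2 ^ k"
          using less_top[OF 1(2) _ x(1)] True by (simp add: b2 del: power_Suc)
        have rk_v: "rk v = 2 ^ k + k + 1 + b * 2 ^ i * (2 * k + 3) + (k - i)"
          using True unfolding 3 rk.simps b_def[symmetric] by simp
        have "rk u \<le> 2 ^ k + k + 1 + b div 2 * 2 ^ Suc i * (2 * k + 3) + (k - Suc i)"
          using 1(2) y unfolding 1(1) rk.simps mem_block_iff
          by (cases "Suc i < k") (auto simp del: power_Suc)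
        moreover have "b div 2 * 2 ^ Suc i * (2 * k + 3) \<le> b * 2 ^ i * (2 * k + 3)"
          by simp
        moreover have "k - Suc i < k - i"
          using True by simp
        ultimately have "rk u < rk v"
          unfolding rk_v by linarith
        then show ?thesis
          using y True 1(1) by (simp add: block_top)
      next
        case 2
        have y: "y < 2 ^ k"
          using less_top[OF 2(2) _ x] by (simp add: b_def)
        have rk_v: "rk v = 2 ^ k + k + 1 + b * 2 ^ i * (2 * k + 3) + (k - i)"
          using True unfolding 3 rk.simps b_def[symmetric] by simp
        have "Suc (y div 2 ^ i) = b"
          using 2 by (cases b) (auto simp: mem_block_iff)
        then have "rk u = 2 ^ k + b * 2 ^ i * (2 * k + 3) + i"
          unfolding 2(1) rk.simps by simp
        then show ?thesis
          using y x True 2(1) unfolding rk_v by (simp add: block_top)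
      qed
    qed
  qed
qed

section \<open>Expansion of nodes into chains of indegree two\<close>

fun extra :: "node \<Rightarrow> nat" where
  "extra (Src i x) = (if i < k then 1 else Suc k)"
| "extra (Snk i x) = 1"

text \<open>One position per parent, followed by the delay. The long delay \<open>Suc k\<close> is
  affordable since only the \<open>2 ^ k\<close> top sources have it.\<close>

definition len :: "node \<Rightarrow> nat" where
  "len v = length (plist v) + extra v"

definition fin :: "node \<Rightarrow> node \<times> nat" where
  "fin v = (v, len v - 1)"

lemma len_pos: "0 < len v"
  by (cases v) (auto simp: len_def)

definition verts :: "(node \<times> nat) set" where
  "verts = (SIGMA v:nodes. {..<len v})"

definition arcs :: "((node \<times> nat) \<times> (node \<times> nat)) set" where
  "arcs = {((v, j), (v, Suc j)) | v j. v \<in> nodes \<and> Suc j < len v} \<union>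
          {(fin (plist v ! j), (v, j)) | v j. v \<in> nodes \<and> j < length (plist v)}"

definition graph :: dag where
  "graph = (to_nat ` verts, map_prod to_nat to_nat ` arcs)"

lemma finite_verts: "finite verts"
  by (simp add: verts_def)

lemma fin_in_verts: "fin v \<in> verts \<longleftrightarrow> v \<in> nodes"
  using len_pos[of v] by (auto simp: fin_def verts_def)

lemma arcs_in_verts: "arcs \<subseteq> verts \<times> verts"
proof -
  have "fin (plist v ! j) \<in> verts" if "v \<in> nodes" "j < length (plist v)" for v j
    using par_rk[OF that(1)] that(2) by (simp add: fin_in_verts)
  moreover have "(v, j) \<in> verts" if "v \<in> nodes" "j < len v" for v j
    using that by (simp add: verts_def)
  moreover have "j < len v" if "j < length (plist v) \<or> Suc j < len v" for v j
    using that by (auto simp: len_def)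
  ultimately show ?thesis
    unfolding arcs_def by blast
qed

lemma length_plist_le:
  "length (plist (Snk i x)) \<le> 2 * D + 1"
  "i < k \<Longrightarrow> length (plist (Src i x)) \<le> 2 * D"
  "length (plist (Src k x)) \<le> k * D"
proof -
  show "length (plist (Snk i x)) \<le> 2 * D + 1"
    by (cases i) auto
  show "length (plist (Src i x)) \<le> 2 * D" if "i < k"
    using that by auto
  have "(\<Sum>j\<leftarrow>[0..<k]. if x div 2 ^ j = 0 then 0 else D) \<le> (\<Sum>j\<leftarrow>[0..<k]. D)"
    by (intro sum_list_mono) auto
  then show "length (plist (Src k x)) \<le> k * D"
    by (simp add: length_concat o_def if_distrib[of length] sum_list_triv cong: if_cong)
qed

lemma len_le:
  "len (Snk i x) \<le> 2 * D + 2"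
  "i < k \<Longrightarrow> len (Src i x) \<le> 2 * D + 1"
  "len (Src k x) \<le> Suc k * (D + 1)"
  using length_plist_le(1)[of i x] length_plist_le(2)[of i x] length_plist_le(3)[of x]
  by (simp_all add: len_def)

text \<open>Chains of length proportional to \<open>k\<close> occur only at the top sources;
  elsewhere \<open>k + 1\<close> levels of \<open>2 ^ k\<close> nodes have chains of bounded length.
  The factor is \<open>(2 * D + 2) + (D + 1) + (2 * D + 2)\<close>.\<close>

lemma card_verts: "card verts \<le> (5 * D + 5) * (Suc k * 2 ^ k)"
proof -
  have inj: "inj_on (Src i) X" "inj_on (Snk i) X" for i X
    by (auto intro: inj_onI)
  have "card verts = (\<Sum>v\<in>nodes. len v)"
    by (simp add: verts_def)
  also have "nodes = (\<Union>j\<le>k. Src j ` block k 0) \<union> (\<Union>j\<le>k. Snk j ` block k 0)"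
    by (auto simp: copy_def)
  also have "(\<Sum>v\<in>\<dots>. len v) = (\<Sum>v\<in>(\<Union>j\<le>k. Src j ` block k 0). len v) +
      (\<Sum>v\<in>(\<Union>j\<le>k. Snk j ` block k 0). len v)"
    by (intro sum.union_disjoint) auto
  also have "(\<Sum>v\<in>(\<Union>j\<le>k. Src j ` block k 0). len v) = (\<Sum>j\<le>k. \<Sum>x\<in>block k 0. len (Src j x))"
    by (subst sum.UNION_disjoint) (auto simp: sum.reindex inj)
  also have "(\<Sum>v\<in>(\<Union>j\<le>k. Snk j ` block k 0). len v) = (\<Sum>j\<le>k. \<Sum>x\<in>block k 0. len (Snk j x))"
    by (subst sum.UNION_disjoint) (auto simp: sum.reindex inj)
  also have "(\<Sum>j\<le>k. \<Sum>x\<in>block k 0. len (Snk j x)) \<le> (\<Sum>j\<le>k. \<Sum>x\<in>block k 0. 2 * D + 2)"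
    by (intro sum_mono len_le)
  also have "(\<Sum>j\<le>k. \<Sum>x\<in>block k 0. len (Src j x)) =
      (\<Sum>j<k. \<Sum>x\<in>block k 0. len (Src j x)) + (\<Sum>x\<in>block k 0. len (Src k x))"
    by (simp add: lessThan_Suc_atMost[symmetric])
  also have "(\<Sum>j<k. \<Sum>x\<in>block k 0. len (Src j x)) \<le> (\<Sum>j<k. \<Sum>x\<in>block k 0. 2 * D + 1)"
    by (intro sum_mono len_le) auto
  also have "(\<Sum>x\<in>block k 0. len (Src k x)) \<le> (\<Sum>x\<in>block k 0. Suc k * (D + 1))"
    by (intro sum_mono len_le)
  finally have "card verts \<le> k * (2 ^ k * (2 * D + 1)) + 2 ^ k * (Suc k * (D + 1)) +
      Suc k * (2 ^ k * (2 * D + 2))"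
    by simp
  also have "\<dots> \<le> Suc k * (2 ^ k * (2 * D + 2)) + 2 ^ k * (Suc k * (D + 1)) +
      Suc k * (2 ^ k * (2 * D + 2))"
    by (intro add_mono mult_le_mono) auto
  also have "\<dots> = (5 * D + 5) * (Suc k * 2 ^ k)"
    by (simp add: algebra_simps)
  finally show ?thesis .
qed

text \<open>Lexicographic in \<open>rk\<close> and the chain position: the multiplier bounds the
  length of every chain.\<close>

definition rank :: "node \<times> nat \<Rightarrow> nat" where
  "rank = (\<lambda>(v, j). rk v * (2 * D + 2 + Suc k * (D + 1)) + j)"

lemma arcs_rank:
  assumes "(a, b) \<in> arcs"
  shows "rank a < rank b"
  using assms unfolding arcs_def
proof (elim UnE CollectE exE conjE)
  fix v j assume *: "(a, b) = (fin (plist v ! j), (v, j))" "v \<in> nodes" "j < length (plist v)"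
  define u where "u = plist v ! j"
  define M where "M = 2 * D + 2 + Suc k * (D + 1)"
  have u: "u \<in> nodes" "rk u < rk v"
    using par_rk[OF *(2)] *(3) by (auto simp: u_def)
  have "len u \<le> M"
  proof (cases u)
    case (Src i x)
    then consider "i < k" | "i = k"
      using u(1) by force
    then show ?thesis
      using len_le(2)[of i x] len_le(3)[of x] by cases (auto simp: M_def Src)
  next
    case (Snk i x)
    then show ?thesis
      using len_le(1)[of i x] by (simp add: M_def)
  qed
  then have "len u - 1 < M"
    using len_pos[of u] by linarith
  then have "rank (fin u) < Suc (rk u) * M"
    unfolding rank_def fin_def prod.case M_def[symmetric] by simp
  also have "\<dots> \<le> rk v * M"
    using u(2) by (intro mult_le_mono1) simp
  also have "\<dots> \<le> rank (v, j)"
    unfolding rank_def prod.case M_def[symmetric] by simp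
  finally show "rank a < rank b"
    using *(1) by (simp add: u_def)
qed (auto simp: rank_def)

lemma edges_rank:
  assumes "(x, y) \<in> snd graph"
  shows "rank (from_nat x) < rank (from_nat y)"
  using assms arcs_rank by (auto simp: graph_def)

lemma graph_is_dag: "is_dag graph"
proof -
  have "snd graph \<subseteq> measure (\<lambda>x. rank (from_nat x))"
    using edges_rank by auto
  then have "acyclic (snd graph)"
    using wf_acyclic wf_measure wf_subset by blast
  moreover have "snd graph \<subseteq> fst graph \<times> fst graph"
    using arcs_in_verts by (auto simp: graph_def)
  ultimately show ?thesis
    using finite_verts by (simp add: is_dag_def graph_def)
qed

lemma card_graph: "card (fst graph) \<le> (5 * D + 5) * (Suc k * 2 ^ k)"
  using card_verts card_image_le[OF finite_verts, of to_nat] by (simp add: graph_def)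

lemma graph_indegree: "indeg_le graph 2"
  unfolding indeg_le_def
proof
  fix x assume "x \<in> fst graph"
  then obtain a :: "node \<times> nat" where "x = to_nat a"
    unfolding graph_def fst_conv by blast
  then obtain v :: node and j :: nat where x: "x = to_nat (v, j)"
    by (cases a) auto
  have "parents graph x \<subseteq> {to_nat (v, j - 1), to_nat (fin (plist v ! j))}"
    by (auto simp: parents_def graph_def arcs_def x)
  then have "card (parents graph x) \<le> card {to_nat (v, j - 1), to_nat (fin (plist v ! j))}"
    by (intro card_mono) auto
  also have "\<dots> \<le> 2"
    by (simp add: card_insert_if)
  finally show "card (parents graph x) \<le> 2" .
qed

text \<open>Without a pebbling the infimum in the definition of ss_par would be a junk value.\<close>

lemma pebblings_nonempty: "par_pebblings graph \<noteq> {}"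
proof -
  define M where "M = Suc (\<Sum>a\<in>verts. rank a)"
  define P where "P = map (\<lambda>i. {x \<in> fst graph. rank (from_nat x) < i}) [0..<Suc M]"
  have nth: "P ! i = {x \<in> fst graph. rank (from_nat x) < i}" if "i < Suc M" for i
    using that unfolding P_def by (simp del: upt_Suc)
  have len: "length P = Suc M"
    by (simp add: P_def)
  have "legal_pebbling graph P"
    unfolding legal_pebbling_def
  proof (intro conjI allI impI ballI subsetI)
    show "P \<noteq> []"
      using len by auto
    show "P ! 0 = {}"
      by (simp add: nth)
    show "x \<in> fst graph" if "i < length P" "x \<in> P ! i" for i x
      using that by (auto simp: nth len)
    show "u \<in> P ! (i - 1)" if i: "1 \<le> i \<and> i < length P" and x: "x \<in> P ! i - P ! (i - 1)"
      and u: "u \<in> parents graph x" for i x u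
    proof -
      have "(u, x) \<in> snd graph"
        using u by (simp add: parents_def)
      then have "rank (from_nat u) < rank (from_nat x)" "u \<in> fst graph"
        using edges_rank graph_is_dag by (auto simp: is_dag_def)
      moreover have "rank (from_nat x) < i"
        using x i by (auto simp: nth len)
      ultimately show ?thesis
        using i by (auto simp: nth len)
    qed
  qed
  moreover have "complete_pebbling graph P"
    unfolding complete_pebbling_def
  proof
    fix x assume "x \<in> sinks graph"
    then obtain a where a: "a \<in> verts" "x = to_nat a"
      by (auto simp: sinks_def graph_def)
    have "rank a \<le> (\<Sum>a\<in>verts. rank a)"
      using a(1) finite_verts by (intro member_le_sum) auto
    then have "x \<in> P ! M"
      using a by (auto simp: nth graph_def M_def)
    then show "\<exists>z<length P. x \<in> P ! z"
      using len by auto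
  qed
  ultimately show ?thesis
    by (auto simp: par_pebblings_def)
qed

lemma top_sink: "x < 2 ^ k \<Longrightarrow> to_nat (fin (Snk k x)) \<in> sinks graph"
proof -
  assume x: "x < 2 ^ k"
  have "(fin (Snk k x), b) \<notin> arcs" for b
  proof
    assume "(fin (Snk k x), b) \<in> arcs"
    then obtain v where "v \<in> nodes" "Snk k x \<in> par v"
      using len_pos[of "Snk k x"] by (auto simp: arcs_def fin_def)
    then show False
      by (cases v rule: plist.cases) (auto split: if_splits)
  qed
  then show ?thesis
    using x by (auto simp: sinks_def graph_def fin_in_verts block_top)
qed

end

section \<open>Space and time in a fixed pebbling\<close>

locale pebbled_graph = pebble_graph +
  fixes P :: "nat set list"
  assumes P: "P \<in> par_pebblings graph"
begin

text \<open>After the end of \<open>P\<close> all pebbles are removed, which is always legal, so the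
  step rule holds at all times.\<close>

definition conf :: "nat \<Rightarrow> (node \<times> nat) set" where
  "conf y = (if y < length P then {a. to_nat a \<in> P ! y} else {})"

lemma conf_subset: "conf y \<subseteq> verts"
proof
  fix a assume "a \<in> conf y"
  then have "to_nat a \<in> fst graph"
    using P by (auto simp: conf_def par_pebblings_def legal_pebbling_def split: if_splits)
  then show "a \<in> verts"
    by (simp add: graph_def inj_image_mem_iff)
qed

lemma conf_0: "conf 0 = {}"
  using P by (auto simp: conf_def par_pebblings_def legal_pebbling_def)

lemma conf_step:
  assumes "b \<in> conf (Suc y)" "b \<notin> conf y" "(a, b) \<in> arcs"
  shows "a \<in> conf y"
proof -
  have y: "Suc y < length P"
    using assms(1) by (auto simp: conf_def split: if_splits)
  then have "to_nat b \<in> P ! Suc y - P ! y"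
    using assms(1,2) by (auto simp: conf_def)
  then have "parents graph (to_nat b) \<subseteq> P ! y"
    using P y unfolding par_pebblings_def legal_pebbling_def by fastforce
  moreover have "to_nat a \<in> parents graph (to_nat b)"
    using assms(3) by (force simp: parents_def graph_def)
  ultimately show ?thesis
    using y by (auto simp: conf_def)
qed

definition Q :: "nat \<Rightarrow> node set" where
  "Q y = fst ` conf y"

definition R :: "nat \<Rightarrow> node set" where
  "R y = {v. fin v \<in> conf y}"

lemma finite_conf: "finite (conf y)"
  using conf_subset finite_verts finite_subset by blast

lemma not_in_Q: "v \<notin> Q z \<Longrightarrow> (v, j) \<notin> conf z"
  unfolding Q_def by (metis fst_conv image_eqI)

lemma conf_nodes: "(v, j) \<in> conf t \<Longrightarrow> v \<in> nodes \<and> j < len v"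
  using conf_subset[of t] by (auto simp: verts_def)

lemma conf_entry:
  assumes "b \<in> conf t" "b \<notin> conf z" "z < t"
  shows "\<exists>s. z \<le> s \<and> Suc s \<le> t \<and> (\<forall>a. (a, b) \<in> arcs \<longrightarrow> a \<in> conf s)"
proof -
  obtain s where s: "z \<le> s" "s \<le> t" "b \<notin> conf s" "\<forall>y. s < y \<and> y \<le> t \<longrightarrow> b \<in> conf y"
    using last_low_time[of "\<lambda>y. b \<notin> conf y" z t] assms by auto
  have "s \<noteq> t"
    using s(3) assms(1) by auto
  then have "b \<in> conf (Suc s)"
    using s(2,4) by auto
  then show ?thesis
    using s(1,2) \<open>s \<noteq> t\<close> conf_step[OF _ s(3)] by (meson Suc_leI le_neq_implies_less)
qed

text \<open>On a chain that is empty at \<open>z\<close>, pebbles advance at most one position per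
  step. Position \<open>l\<close> is thus entered at least \<open>j - l\<close> steps before
  \<open>t\<close>, and its parent must be finished just before that.\<close>

lemma chain_delay:
  assumes "(v, j) \<in> conf t" "v \<notin> Q z" "z < t" "l \<le> j" "l < length (plist v)"
  shows "\<exists>y. z \<le> y \<and> y + 1 + (j - l) \<le> t \<and> plist v ! l \<in> R y"
  using assms(1,3,4)
proof (induction j arbitrary: t)
  case (0 t)
  have not_z: "(v, 0) \<notin> conf z" and "v \<in> nodes"
    using not_in_Q[OF assms(2)] conf_nodes[OF 0(1)] by auto
  then have "(fin (plist v ! 0), (v, 0)) \<in> arcs"
    using assms(5) 0 unfolding arcs_def by auto
  then obtain s where "z \<le> s" "Suc s \<le> t" "fin (plist v ! 0) \<in> conf s"
    using conf_entry[OF 0(1) not_z 0(2)] by blast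
  then show ?case
    using 0(3) by (intro exI[of _ s]) (simp add: R_def)
next
  case (Suc j t)
  have not_z: "(v, Suc j) \<notin> conf z" and v: "v \<in> nodes" "Suc j < len v"
    using not_in_Q[OF assms(2)] conf_nodes[OF Suc.prems(1)] by auto
  obtain s where s: "z \<le> s" "Suc s \<le> t" "\<And>a. (a, (v, Suc j)) \<in> arcs \<Longrightarrow> a \<in> conf s"
    using conf_entry[OF Suc.prems(1) not_z Suc.prems(2)] by blast
  show ?case
  proof (cases "l = Suc j")
    case True
    then have "(fin (plist v ! l), (v, Suc j)) \<in> arcs"
      using assms(5) v unfolding arcs_def by auto
    then have "fin (plist v ! l) \<in> conf s"
      by (rule s(3))
    then show ?thesis
      using s(1,2) True by (intro exI[of _ s]) (simp add: R_def)
  next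
    case False
    have "((v, j), (v, Suc j)) \<in> arcs"
      using v unfolding arcs_def by auto
    then have vj: "(v, j) \<in> conf s"
      using s(3) by blast
    then have "s \<noteq> z"
      using not_in_Q[OF assms(2)] by blast
    then obtain y where "z \<le> y" "y + 1 + (j - l) \<le> s" "plist v ! l \<in> R y"
      using Suc.IH[OF vj] s(1) False Suc.prems(3) by auto
    then show ?thesis
      using s(2) False Suc.prems(3) by (intro exI[of _ y]) auto
  qed
qed

lemma delayed_legal:
  assumes "v \<notin> Q z" "v \<in> R t" "z < t" "u \<in> par v"
  shows "\<exists>y. z \<le> y \<and> y + 1 + extra v \<le> t \<and> u \<in> R y"
proof -
  obtain l where l: "l < length (plist v)" "u = plist v ! l"
    using assms(4) by (metis in_set_conv_nth)
  have "extra v \<le> len v - 1 - l"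
    using l(1) by (simp add: len_def)
  moreover have "(v, len v - 1) \<in> conf t" "l \<le> len v - 1"
    using assms(2) l(1) by (auto simp: R_def fin_def len_def)
  ultimately show ?thesis
    using chain_delay[OF _ assms(1,3) _ l(1)] l(2) by fastforce
qed

sublocale coarse_pebbling par Q R
proof
  show "finite (Q y)" for y
    by (simp add: Q_def finite_conf)
  show "R y \<subseteq> Q y" for y
    by (force simp: R_def Q_def fin_def)
  show "\<exists>y. z \<le> y \<and> y < t \<and> u \<in> R y" if "v \<notin> Q z" "v \<in> R t" "z < t" "u \<in> par v" for v z t u
  proof -
    from delayed_legal[OF that] obtain y where "z \<le> y" "y + 1 + extra v \<le> t" "u \<in> R y"
      by blast
    then show ?thesis
      by (intro exI[of _ y]) simp
  qed
qed

text \<open>The pebbling begins empty and completeness makes every top sink new, so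
  \<open>robust_copy\<close> applies to the entire time span.\<close>

lemma sustained_interval:
  "\<exists>z t. t < length P \<and> sustained (2 ^ k) nodes (Src k ` block k 0) z t"
proof -
  have Q0: "Q 0 = {}"
    by (simp add: Q_def conf_0)
  have "Snk k ` block k 0 \<subseteq> new 0 (length P - 1)"
  proof
    fix v assume "v \<in> Snk k ` block k 0"
    then obtain x where x: "v = Snk k x" "x < 2 ^ k"
      by (auto simp: block_top)
    then obtain y where y: "y < length P" "to_nat (fin v) \<in> P ! y"
      using P top_sink[of x] by (auto simp: par_pebblings_def complete_pebbling_def)
    then have "v \<in> R y"
      by (simp add: R_def conf_def)
    moreover have "0 < y"
      using \<open>v \<in> R y\<close> conf_0 by (cases y) (auto simp: R_def)
    ultimately show "v \<in> new 0 (length P - 1)"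
      using y(1) by (auto simp: new_def Q0 intro!: exI[of _ y])
  qed
  then have "Snk k ` block k 0 \<inter> new 0 (length P - 1) = Snk k ` block k 0"
    by blast
  then obtain z t where "t \<le> length P - 1" "sustained (2 ^ k) nodes (Src k ` block k 0) z t"
    using robust_copy[OF coarse_pebbling_axioms, of k 0] Q0
    unfolding robust_def by (metis Int_empty_left card.empty card_Snk_block le_add1 mult_0_right
        mult_2 order_refl zero_le)
  moreover have "P \<noteq> []"
    using P by (simp add: par_pebblings_def legal_pebbling_def)
  ultimately show ?thesis
    by (intro exI[of _ z] exI[of _ t]) (cases P; auto)
qed

text \<open>The sources that are not new are deleted from the depth-robust graph. The remaining good
  ones lie on a common path of new sources, and each edge of this path costs a full delay.\<close>

lemma sustained_length:
  assumes "sustained (2 ^ k) nodes (Src k ` block k 0) z t"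
  shows "Suc (Suc k) * 2 ^ k \<le> 16 * (t - z)"
proof -
  define U where "U = {x \<in> block k 0. Src k x \<in> new z t}"
  define S where "S = block k 0 - U"
  have "Src k ` block k 0 \<inter> new z t = Src k ` U"
    by (auto simp: U_def)
  then have "63 * 2 ^ k \<le> 64 * card U"
    using assms by (simp add: sustained_def card_image inj_on_def)
  moreover have "card S = 2 ^ k - card U"
    by (simp add: S_def U_def card_Diff_subset)
  ultimately have S: "64 * card S \<le> 2 ^ k"
    by linarith
  interpret dyadic_expander lpar S
    by standard (auto simp: expands_lpar S_def)
  have S_sub: "S \<subseteq> {..<2 ^ k}"
    by (auto simp: S_def block_top)
  define W where "W = {x \<in> block k 0. good x}"
  have "card (block k 0) \<le> card (W \<union> {v. \<not> good v})"
    using card_not_good(2)[OF S_sub S] by (intro card_mono) (auto simp: W_def)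
  also have "\<dots> \<le> card W + 24 * card S"
    using card_Un_le[of W "{v. \<not> good v}"] card_not_good(1)[OF S_sub S] by linarith
  \<comment> \<open>At most \<open>24 / 64 = 3 / 8\<close> of the indices are lost.\<close>
  finally have W: "5 * 2 ^ k \<le> 8 * card W"
    using S by simp
  have "card W \<noteq> 0"
  proof
    assume "card W = 0"
    moreover have "(0::nat) < 2 ^ k"
      by simp
    ultimately show False
      using W by linarith
  qed
  then have W_ne: "finite W" "W \<noteq> {}"
    by (auto simp: W_def)
  have W_U: "x \<in> U" if "x \<in> W" for x
  proof -
    have "light 0 x"
      using that unfolding W_def good_def by (metis (mono_tags, lifting) div_by_1 mem_Collect_eq power_0)
    then show ?thesis
      using light_0[of x] that by (auto simp: S_def W_def)
  qed
  define \<tau> where "\<tau> x = (LEAST y. z < y \<and> Src k x \<in> R y)" for x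
  have \<tau>: "z < \<tau> x" "\<tau> x \<le> t" "Src k x \<in> R (\<tau> x)" if x: "x \<in> U" for x
  proof -
    obtain y where y: "z < y" "y \<le> t" "Src k x \<in> R y"
      using x by (auto simp: U_def new_def)
    then show "z < \<tau> x" "Src k x \<in> R (\<tau> x)"
      using LeastI[of "\<lambda>y. z < y \<and> Src k x \<in> R y" y] by (auto simp: \<tau>_def)
    have "\<tau> x \<le> y"
      unfolding \<tau>_def using y by (intro Least_le) auto
    then show "\<tau> x \<le> t"
      using y(2) by simp
  qed
  \<comment> \<open>The gap \<open>k + 2\<close> is one step for reading the parent plus the delay
    \<open>Suc k\<close> of a top source. Both endpoints are new, so the parent is completed
    strictly after \<open>z\<close>.\<close>
  have step: "\<tau> u + (k + 2) \<le> \<tau> v" if "(u, v) \<in> edges" "v < 2 ^ k" for u v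
  proof -
    have u: "u \<in> lpar v" "u \<notin> S" "v \<notin> S"
      using that(1) by (auto simp: edges_def)
    then have "u < v"
      using lpar_less by blast
    then have U: "u \<in> U" "v \<in> U"
      using u that(2) by (auto simp: S_def block_top)
    then have notin: "Src k u \<notin> Q z" "Src k v \<notin> Q z"
      by (auto simp: U_def new_def)
    have "Src k u \<in> par (Src k v)"
      using u(1) par_Src_top[OF that(2)] by blast
    then obtain y where y: "z \<le> y" "y + 1 + extra (Src k v) \<le> \<tau> v" "Src k u \<in> R y"
      using delayed_legal[OF notin(2) \<tau>(3)[OF U(2)] \<tau>(1)[OF U(2)]] by blast
    moreover have "y \<noteq> z"
      using y(3) notin(1) R_subset_Q by auto
    ultimately have "\<tau> u \<le> y"
      unfolding \<tau>_def by (intro Least_le) auto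
    then show ?thesis
      using y(2) by simp
  qed
  have path: "\<tau> u + (k + 2) \<le> \<tau> v" if "(u, v) \<in> edges\<^sup>+" "v < 2 ^ k" for u v
    using that
  proof (induction rule: trancl_induct)
    case (base y)
    then show ?case
      using step by blast
  next
    case (step y w)
    then have "y < w"
      using lpar_less by (auto simp: edges_def)
    then have "\<tau> u + (k + 2) \<le> \<tau> y"
      using step by simp
    then show ?case
      using \<open>\<And>u v. (u, v) \<in> edges \<Longrightarrow> v < 2 ^ k \<Longrightarrow> \<tau> u + (k + 2) \<le> \<tau> v\<close>[OF step(2,4)] by linarith
  qed
  have "(card W - 1) * (k + 2) + \<tau> (Min W) \<le> \<tau> (Max W)"
    using W_ne
  proof (rule iterated_gap)
    show "\<tau> g + (k + 2) \<le> \<tau> h" if "g \<in> W" "h \<in> W" "g < h" for g h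
      using that good_connected[of g h] path[of g h] by (auto simp: W_def block_top)
  qed
  moreover have "z < \<tau> (Min W)" "\<tau> (Max W) \<le> t"
    using \<tau> W_U W_ne Min_in Max_in by blast+
  ultimately have length: "(card W - 1) * (k + 2) + 1 \<le> t - z"
    by linarith
  \<comment> \<open>For \<open>k = 0\<close> the factor \<open>card W - 1\<close> may vanish and the
    summand 1 in \<open>length\<close> is what remains. Otherwise \<open>2 ^ k\<close> is at least
    2, so subtracting 1 from \<open>card W\<close> is absorbed by the factor 16.\<close>
  show ?thesis
  proof (cases k)
    case 0
    then show ?thesis
      using length by simp
  next
    case (Suc k')
    then have "(2::nat) \<le> 2 ^ k"
      by simp
    then have "2 ^ k \<le> 16 * (card W - 1)"
      using W by linarith
    then have "2 ^ k * (k + 2) \<le> 16 * (card W - 1) * (k + 2)"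
      by (rule mult_le_mono1)
    then show ?thesis
      using length by (simp add: mult.commute)
  qed
qed

lemma ss_cost_ge:
  assumes "256 * s \<le> 2 ^ k"
  shows "Suc (Suc k) * 2 ^ k \<le> 16 * ss_cost P s"
proof -
  obtain z t where t: "t < length P" and sus: "sustained (2 ^ k) nodes (Src k ` block k 0) z t"
    using sustained_interval by blast
  have "{z<..t} \<subseteq> {i \<in> {1..<length P}. s \<le> real (card (P ! i))}"
  proof
    fix y assume y: "y \<in> {z<..t}"
    then have "2 ^ k \<le> 256 * card (Q y \<inter> nodes)"
      using sus by (auto simp: sustained_def)
    moreover have "card (Q y \<inter> nodes) \<le> card (Q y)"
      using finite_Q by (intro card_mono) auto
    moreover have "card (Q y) \<le> card (conf y)"
      unfolding Q_def using finite_conf by (rule card_image_le)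
    moreover have "card (conf y) \<le> card (P ! y)"
    proof (rule card_inj_on_le[of to_nat])
      have "P ! y \<subseteq> fst graph"
        using P y t by (auto simp: par_pebblings_def legal_pebbling_def)
      then show "finite (P ! y)"
        using graph_is_dag finite_subset by (auto simp: is_dag_def)
      show "to_nat ` conf y \<subseteq> P ! y"
        by (auto simp: conf_def)
    qed simp
    ultimately have "2 ^ k \<le> 256 * card (P ! y)"
      by linarith
    then have "real (2 ^ k) \<le> real (256 * card (P ! y))"
      by (rule of_nat_mono)
    then show "y \<in> {i \<in> {1..<length P}. s \<le> real (card (P ! i))}"
      using y t assms by auto
  qed
  then have "card {z<..t} \<le> ss_cost P s"
    unfolding ss_cost_def by (intro card_mono) auto
  then show ?thesis
    using sustained_length[OF sus] by simp
qed

end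

section \<open>Minimum over all pebblings and choice of the level for a given size\<close>

lemma (in pebble_graph) ss_par_ge:
  assumes "256 * s \<le> 2 ^ k"
  shows "Suc (Suc k) * 2 ^ k \<le> 16 * ss_par graph s"
proof -
  have "ss_par graph s \<in> (\<lambda>P. ss_cost P s) ` par_pebblings graph"
    unfolding ss_par_def using pebblings_nonempty by (intro Inf_nat_def1) auto
  then obtain P where *: "P \<in> par_pebblings graph" "ss_par graph s = ss_cost P s"
    by blast
  interpret pebbled_graph D k E P
    by standard (rule *(1))
  show ?thesis
    using ss_cost_ge[OF assms] *(2) by simp
qed

text \<open>Up to a constant, \<open>Suc k * 2 ^ k\<close> is the size of the graph of level
  \<open>k\<close>. Consecutive values differ by a factor of at most 4, so every \<open>n\<close> is
  matched up to a constant.\<close>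

lemma exponent_exists:
  assumes "2 \<le> (n::nat)"
  shows "\<exists>k. Suc k * 2 ^ k \<le> n \<and> n < Suc (Suc k) * 2 ^ Suc k"
proof -
  let ?P = "\<lambda>k. n < Suc (Suc k) * 2 ^ Suc k"
  have "n < 2 ^ n"
    by (rule less_exp)
  also have "\<dots> \<le> Suc (Suc n) * 2 ^ Suc n"
    by simp
  finally have ex: "?P n" .
  define k where "k = (LEAST k. ?P k)"
  have "?P k"
    unfolding k_def using ex by (rule LeastI)
  moreover have "Suc k * 2 ^ k \<le> n"
  proof (cases k)
    case 0
    then show ?thesis
      using assms by simp
  next
    case (Suc k')
    then have "\<not> ?P k'"
      using not_less_Least[of k' ?P] unfolding k_def[symmetric] by simp
    then show ?thesis
      using Suc by simp
  qed
  ultimately show ?thesis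
    by blast
qed

theorem mainTheorem3:
  shows "\<exists>C c4 c5 :: real. C > 0 \<and> c4 > 0 \<and> c5 > 0 \<and>
    (\<exists>G :: nat \<Rightarrow> dag. \<forall>n \<ge> 2.
       is_dag (G n) \<and> real (card (fst (G n))) \<le> C * real n \<and> indeg_le (G n) 2 \<and>
       real (ss_par (G n) (c4 * real n / log 2 (real n))) \<ge> c5 * real n)"
proof -
  obtain D where D: "\<forall>p q. 0 < p \<longrightarrow> 0 < q \<longrightarrow> p \<le> 2 * q \<longrightarrow> (\<exists>E. is_expander D p q E)"
    using expanders_exist by blast
  define E where "E = (\<lambda>p q. SOME E. is_expander D p q E)"
  have E: "is_expander D p q (E p q)" if "0 < p" "0 < q" "p \<le> 2 * q" for p q
  proof -
    have "\<exists>E. is_expander D p q E"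
      using D that by simp
    then show ?thesis
      unfolding E_def by (rule someI_ex)
  qed
  have pg: "pebble_graph D E"
    by standard (rule E)
  define C :: real where "C = 5 * real D + 5"
  \<comment> \<open>Here \<open>1/32 = 1 / (16 * 2)\<close>, where 16 comes from
    \<open>ss_par_ge\<close> and 2 from \<open>n_upper\<close>. Since \<open>n\<close> is at least
    2, \<open>k + 2\<close> is at most three times the logarithm, so \<open>n\<close> is at most
    \<open>6 * log 2 n * 2 ^ k\<close>; hence \<open>1536 = 6 * 256\<close>.\<close>
  have "\<exists>G. is_dag G \<and> real (card (fst G)) \<le> C * real n \<and> indeg_le G 2 \<and>
       real (ss_par G (1 / 1536 * real n / log 2 (real n))) \<ge> 1 / 32 * real n" if n: "2 \<le> n" for n
  proof -
    obtain k where k: "Suc k * 2 ^ k \<le> n" "n < Suc (Suc k) * 2 ^ Suc k"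
      using exponent_exists[OF n] by blast
    interpret pebble_graph D k E
      by (rule pg)
    have "card (fst graph) \<le> (5 * D + 5) * n"
      using card_graph k(1) by (meson le_trans mult_le_mono2)
    then have "real (card (fst graph)) \<le> real ((5 * D + 5) * n)"
      by (rule of_nat_mono)
    then have card: "real (card (fst graph)) \<le> C * real n"
      by (simp add: C_def)
    have n_upper: "real n \<le> 2 * ((real k + 2) * 2 ^ k)"
    proof -
      have "real n \<le> real (Suc (Suc k) * 2 ^ Suc k)"
        using k(2) by (intro of_nat_mono) simp
      then show ?thesis
        by (simp add: algebra_simps)
    qed
    have "2 ^ k \<le> n"
      using k(1) by simp
    then have "(2::real) ^ k \<le> real n"
      by (metis of_nat_le_iff of_nat_numeral of_nat_power)
    then have "real k \<le> log 2 (real n)"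
      using n by (simp add: le_log_iff powr_realpow)
    moreover have "1 \<le> log 2 (real n)"
      using n by (simp add: le_log_iff)
    ultimately have log: "(real k + 2) \<le> 3 * log 2 (real n)" "0 < log 2 (real n)"
      by linarith+
    have "(real k + 2) * 2 ^ k \<le> 3 * log 2 (real n) * 2 ^ k"
      using log(1) by (intro mult_right_mono) auto
    then have "real n \<le> 6 * log 2 (real n) * 2 ^ k"
      using n_upper by linarith
    then have "256 * (1 / 1536 * real n / log 2 (real n)) \<le> 2 ^ k"
      using log(2) by (simp add: field_simps)
    then have "Suc (Suc k) * 2 ^ k \<le> 16 * ss_par graph (1 / 1536 * real n / log 2 (real n))"
      by (rule ss_par_ge)
    then have "real (Suc (Suc k) * 2 ^ k) \<le>
        real (16 * ss_par graph (1 / 1536 * real n / log 2 (real n)))"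
      by (rule of_nat_mono)
    then have "real (ss_par graph (1 / 1536 * real n / log 2 (real n))) \<ge> 1 / 32 * real n"
      using n_upper by (simp add: algebra_simps)
    then show ?thesis
      using graph_is_dag card graph_indegree by blast
  qed
  then obtain G where "\<forall>n\<ge>2. is_dag (G n) \<and> real (card (fst (G n))) \<le> C * real n \<and>
      indeg_le (G n) 2 \<and> real (ss_par (G n) (1 / 1536 * real n / log 2 (real n))) \<ge> 1 / 32 * real n"
    by metis
  then show ?thesis
    by (intro exI[of _ C] exI[of _ "1 / 1536"] exI[of _ "1 / 32"]) (auto simp: C_def)
qed

end
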